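(* Let $\mathcal{A}$ be either $\textsc{Bins}^*$ or $\textsc{Bins}(k)$ for some $k \in [m]$, and let $\mathcal{D}$ be a set of demand profiles (each with at least two entries). If $\mathcal{A}$ has competitive ratio $c$ for $\mathcal{D}$, i.e. $\max_{D\in\mathcal D}p_{\mathcal A}(D)/p_*(D)=c$, then $\mathcal{A}$ has competitive ratio at most $4c$ for $\mathrm{Adv}(\mathcal{D})$, i.e. \[\max_{Z\in\mathrm{Adv}(\mathcal D)}\frac{p_{\mathcal A}(Z)}{\mathbb E_{D\sim Z}[p_*(D)]}\le 4c.\]
   Context: Fix $m\in\mathbb N$ and the universe of IDs $[m]=\{1,\dots,m\}$; $\log$ is base 2. An ID-generation algorithm is a randomized procedure (a distribution over orderings of IDs) producing distinct IDs from $[m]$, one per request; instances use independent randomness. For a demand profile $D=(d_1,\dots,d_n)$ ($n$ instances, instance $i$ receiving $d_i$ requests one at a time without knowing $d_i$ in advance), a collision occurs if the sets of output IDs are not pairwise disjoint; $p_{\mathcal A}(D)$ is its probability and $p_*(D)=\min_{\mathcal A'}p_{\mathcal A'}(D)$ over all algorithms. An adaptive adversary $Z$ starts from $D=()$ and at each step either activates a new instance and requests an ID from it (appending an entry $1$), requests another ID from an existing instance (incrementing its entry), or stops with final profile $D$; it observes all IDs produced and may adapt. $p_{\mathcal A}(Z)$ is the collision probability, and $D\sim Z$ denotes the random final demand profile from the interaction of $Z$ with $\mathcal A$. $\mathrm{Adv}(\mathcal D)$ is the set of adaptive adversaries that always stop eventually with final profile in $\mathcal D$. $\textsc{Bins}(k)$: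 partition $[m]$ into $\lfloor m/k\rfloor$ bins of $k$ IDs and $m\bmod k$ leftover IDs; pick a uniformly random permutation of the bins, return all IDs of each shuffled bin in increasing order before the next, then the leftover IDs in increasing order. $\textsc{Bins}^*$: with $C=\lceil\log m-\log\log m\rceil$, partition part of $[m]$ into $C$ chunks of $2^{C-1}$ IDs, the $i$-th chunk into $2^{C-i}$ bins of $2^{i-1}$ IDs; an instance picks a uniformly random bin of chunk 1, then of chunk 2, etc., returning all IDs of a bin in increasing order before moving on. *)

theory Defs
  imports "HOL-Probability.Probability" "HOL-Combinatorics.Multiset_Permutations"
begin

text \<open>
  An instance draws a list of distinct IDs once and answers its \<open>j\<close>-th request by the \<open>j\<close>-th
  entry. For an ID-generation algorithm in the strict sense the list is an ordering of all of
  \<open>[m]\<close>. The larger class of generators also admits lists that run out early, because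
  \<open>Bins\<^sup>*\<close> provides only \<open>2 ^ C - 1\<close> IDs per instance. A request to an exhausted
  instance yields no ID.
\<close>

definition id_algorithm :: "nat \<Rightarrow> nat list pmf \<Rightarrow> bool" where
  "id_algorithm m A \<longleftrightarrow> set_pmf A \<subseteq> permutations_of_set {1..m}"

definition id_generator :: "nat \<Rightarrow> nat list pmf \<Rightarrow> bool" where
  "id_generator m A \<longleftrightarrow> (\<forall>xs\<in>set_pmf A. distinct xs \<and> set xs \<subseteq> {1..m})"

definition demand_profile :: "nat list \<Rightarrow> bool" where
  "demand_profile D \<longleftrightarrow> (\<forall>d\<in>set D. d \<ge> 1)"

text \<open>
  The state of a system of instances: for each instance its (hidden) ID list and the number of
  requests it has received.
\<close>

type_synonym state = "(nat list \<times> nat) list"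

definition output_ids :: "nat list \<times> nat \<Rightarrow> nat set" where
  "output_ids = (\<lambda>(xs, d). set (take d xs))"

definition profile :: "state \<Rightarrow> nat list" where
  "profile s = map snd s"

definition collision :: "state \<Rightarrow> bool" where
  "collision s \<longleftrightarrow> (\<exists>i j. i < j \<and> j < length s \<and> output_ids (s ! i) \<inter> output_ids (s ! j) \<noteq> {})"

definition collision_prob :: "nat list pmf \<Rightarrow> nat list \<Rightarrow> real" where
  "collision_prob A D =
     measure_pmf.prob (replicate_pmf (length D) A) {xss. collision (zip xss D)}"

text \<open>The infimum is a minimum: the algorithms on \<open>[m]\<close> form a compact simplex.\<close>

definition opt_prob :: "nat \<Rightarrow> nat list \<Rightarrow> real" where
  "opt_prob m D = (INF A\<in>{A. id_algorithm m A}. collision_prob A D)"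

definition competitive_ratio :: "nat \<Rightarrow> nat list pmf \<Rightarrow> nat list set \<Rightarrow> ereal" where
  "competitive_ratio m A \<D> = (SUP D\<in>\<D>. ereal (collision_prob A D / opt_prob m D))"

text \<open>
  An adaptive (possibly randomized) adversary is a decision tree. \<open>Request i f\<close> requests an ID
  from instance \<open>i\<close> if at least \<open>i + 1\<close> instances are active and otherwise activates a new
  instance and requests an ID from it; \<open>f\<close> maps the answer (\<open>None\<close> if the instance is
  exhausted) to the distribution of the continuation. The position in the tree encodes all answers
  seen so far. As the datatype is well-founded, every play ends after finitely many steps.
\<close>

datatype adversary = Stop | Request nat "nat option \<Rightarrow> adversary pmf"

definition answer :: "nat list \<times> nat \<Rightarrow> nat option" where
  "answer = (\<lambda>(xs, d). if d \<le> length xs then Some (xs ! (d - 1)) else None)"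

definition request :: "nat list pmf \<Rightarrow> nat \<Rightarrow> state \<Rightarrow> (state \<times> nat option) pmf" where
  "request A i s =
     (if i < length s
      then let p = (fst (s ! i), snd (s ! i) + 1) in return_pmf (s[i := p], answer p)
      else map_pmf (\<lambda>xs. (s @ [(xs, 1)], answer (xs, 1))) A)"

text \<open>
  The distribution of the final state when the adversary plays against instances of \<open>A\<close> from
  a given state.
\<close>

primrec interact :: "nat list pmf \<Rightarrow> adversary \<Rightarrow> state \<Rightarrow> state pmf" where
  "interact A Stop = return_pmf"
| "interact A (Request i f) = (\<lambda>s.
     bind_pmf (request A i s) (\<lambda>(s', r).
       bind_pmf (map_pmf (interact A) (f r)) (\<lambda>play. play s')))"

definition adv_collision_prob :: "nat list pmf \<Rightarrow> adversary \<Rightarrow> real" where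
  "adv_collision_prob A Z = measure_pmf.prob (interact A Z []) {s. collision s}"

definition final_profile :: "nat list pmf \<Rightarrow> adversary \<Rightarrow> nat list pmf" where
  "final_profile A Z = map_pmf profile (interact A Z [])"

definition Adv :: "nat \<Rightarrow> nat list set \<Rightarrow> adversary set" where
  "Adv m \<D> = {Z. \<forall>A. id_generator m A \<longrightarrow> set_pmf (final_profile A Z) \<subseteq> \<D>}"

definition adv_competitive_ratio :: "nat \<Rightarrow> nat list pmf \<Rightarrow> adversary set \<Rightarrow> ereal" where
  "adv_competitive_ratio m A \<Z> =
     (SUP Z\<in>\<Z>. ereal (adv_collision_prob A Z /
        measure_pmf.expectation (final_profile A Z) (opt_prob m)))"

text \<open>
  The way \<open>[m]\<close> is partitioned is left open, so the algorithms are parameterized by the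
  partition.
\<close>

definition bins_partition :: "nat \<Rightarrow> nat \<Rightarrow> nat set set \<Rightarrow> bool" where
  "bins_partition m k \<B> \<longleftrightarrow>
     disjoint \<B> \<and> \<Union>\<B> \<subseteq> {1..m} \<and> card \<B> = m div k \<and> (\<forall>B\<in>\<B>. card B = k)"

definition bins :: "nat \<Rightarrow> nat set set \<Rightarrow> nat list pmf" where
  "bins m \<B> =
     map_pmf (\<lambda>Bs. concat (map sorted_list_of_set Bs) @ sorted_list_of_set ({1..m} - \<Union>\<B>))
       (pmf_of_set (permutations_of_set \<B>))"

definition num_chunks :: "nat \<Rightarrow> nat" where
  "num_chunks m = nat \<lceil>log 2 (real m) - log 2 (log 2 (real m))\<rceil>"

text \<open>\<open>\<C> i\<close> is the set of bins of the \<open>i\<close>-th chunk, and the chunk itself is their union.\<close>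

definition bins_star_partition :: "nat \<Rightarrow> (nat \<Rightarrow> nat set set) \<Rightarrow> bool" where
  "bins_star_partition m \<C> \<longleftrightarrow> (let C = num_chunks m in
     disjoint_family_on (\<lambda>i. \<Union>(\<C> i)) {1..C} \<and>
     (\<forall>i\<in>{1..C}. \<Union>(\<C> i) \<subseteq> {1..m} \<and> card (\<Union>(\<C> i)) = 2 ^ (C - 1) \<and>
        disjoint (\<C> i) \<and> card (\<C> i) = 2 ^ (C - i) \<and> (\<forall>B\<in>\<C> i. card B = 2 ^ (i - 1))))"

definition bins_star :: "nat \<Rightarrow> (nat \<Rightarrow> nat set set) \<Rightarrow> nat list pmf" where
  "bins_star m \<C> =
     map_pmf (\<lambda>b. concat (map (\<lambda>i. sorted_list_of_set (b i)) [1..<Suc (num_chunks m)]))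
       (Pi_pmf {1..num_chunks m} {} (\<lambda>i. pmf_of_set (\<C> i)))"

end

theory Submission
  imports Defs
begin

text \<open>
  Only the sequence of bins opened by each instance matters: two instances collide iff they have
  opened a common bin. As long as there is no collision, the conditional probability \<open>h\<close> of a
  collision at the next request depends only on the demand profile, so the IDs that the adversary
  observes do not help. Writing \<open>q D\<close> for the collision probability of \<open>D\<close>, a request that turns
  \<open>D\<close> into \<open>D'\<close> satisfies \<open>q D' - q D = h * (1 - q D)\<close>. By induction on the adversary, the expected
  value of \<open>2 * q - 1\<^bsub>collision\<^esub>\<close> at the end of the play is at least \<open>q D\<close> from every collision-free
  state with profile \<open>D\<close>: a collision yields at least \<open>2 * q D' - 1\<close>, and
  \<open>h * (2 * q D' - 1) + (1 - h) * q D' = q D' - h * (1 - q D') \<ge> q D\<close>. Starting from the empty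
  profile, an adaptive adversary's collision probability is at most twice the expectation of
  \<open>q D\<close> over its final profile \<open>D\<close>.
\<close>

subsection \<open>Probability mass functions\<close>

text \<open>A uniform bound on \<open>f\<close> stands in for integrability: the continuation
  distributions of an adversary may have infinite support.\<close>

lemma expectation_bind_pmf_bounded:
  fixes f :: "'a \<Rightarrow> real"
  assumes "\<And>x. \<bar>f x\<bar> \<le> B"
  shows "measure_pmf.expectation (bind_pmf M N) f =
    measure_pmf.expectation M (\<lambda>x. measure_pmf.expectation (N x) f)"
  unfolding measure_pmf_bind
  using assms measurable_measure_pmf[of N]
  by (intro integral_bind[where K = "count_space UNIV" and B' = 1 and B = B])
     (auto simp: measure_pmf.emeasure_space_1 measure_pmf.finite_measure_axioms)

lemma expectation_of_bool:
  "measure_pmf.expectation M (\<lambda>x. of_bool (Q x)) = measure_pmf.prob M {x. Q x}"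
proof -
  have "(\<lambda>x. of_bool (Q x) :: real) = indicator {x. Q x}"
    by (auto simp: indicator_def)
  then show ?thesis by simp
qed

lemma integrable_pmf_bounded:
  fixes f :: "'a \<Rightarrow> real"
  assumes "\<And>x. \<bar>f x\<bar> \<le> B"
  shows "integrable (measure_pmf M) f"
  using assms by (intro measure_pmf.integrable_const_bound[where B = B]) auto

lemma expectation_ge_const:
  fixes f :: "'a \<Rightarrow> real"
  assumes "\<And>x. \<bar>f x\<bar> \<le> B" "\<And>x. x \<in> set_pmf M \<Longrightarrow> l \<le> f x"
  shows "l \<le> measure_pmf.expectation M f"
proof -
  have "measure_pmf.expectation M (\<lambda>_. l) \<le> measure_pmf.expectation M f"
    using assms by (intro integral_mono_AE integrable_pmf_bounded[OF assms(1)])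
      (auto simp: AE_measure_pmf_iff)
  then show ?thesis by simp
qed

lemma abs_expectation_le:
  fixes f :: "'a \<Rightarrow> real"
  assumes "\<And>x. \<bar>f x\<bar> \<le> B"
  shows "\<bar>measure_pmf.expectation M f\<bar> \<le> B"
proof -
  have "\<bar>measure_pmf.expectation M f\<bar> \<le> measure_pmf.expectation M (\<lambda>x. \<bar>f x\<bar>)"
    by (rule integral_abs_bound)
  also have "\<dots> \<le> measure_pmf.expectation M (\<lambda>_. B)"
    using assms by (intro integral_mono integrable_abs integrable_pmf_bounded[OF assms]) auto
  finally show ?thesis by simp
qed

text \<open>Total expectation over the values of \<open>f\<close>. Below, \<open>f\<close> maps the
  hidden bin sequences to the bins opened so far, so a fibre collects the hidden outcomes with the
  same opened bins.\<close>

lemma expectation_sum_fibres: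
  fixes g :: "'a \<Rightarrow> real"
  assumes fin: "finite (set_pmf M)"
  shows "measure_pmf.expectation M g =
    (\<Sum>y\<in>f ` set_pmf M. measure_pmf.expectation M (\<lambda>x. of_bool (f x = y) * g x))"
proof -
  have "measure_pmf.expectation M g =
      measure_pmf.expectation M (\<lambda>x. \<Sum>y\<in>f ` set_pmf M. of_bool (f x = y) * g x)"
  proof (rule integral_cong_AE)
    show "AE x in measure_pmf M. g x = (\<Sum>y\<in>f ` set_pmf M. of_bool (f x = y) * g x)"
    proof (unfold AE_measure_pmf_iff, intro ballI)
      fix x assume x: "x \<in> set_pmf M"
      have "(\<Sum>y\<in>f ` set_pmf M. of_bool (f x = y) * g x) = (\<Sum>y\<in>{f x}. of_bool (f x = y) * g x)"
        using x fin by (intro sum.mono_neutral_right) auto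
      then show "g x = (\<Sum>y\<in>f ` set_pmf M. of_bool (f x = y) * g x)" by simp
    qed
  qed auto
  also have "\<dots> = (\<Sum>y\<in>f ` set_pmf M. measure_pmf.expectation M (\<lambda>x. of_bool (f x = y) * g x))"
    by (intro Bochner_Integration.integral_sum integrable_measure_pmf_finite fin)
  finally show ?thesis .
qed

lemma expectation_nonneg_by_fibres:
  fixes g :: "'a \<Rightarrow> real"
  assumes "finite (set_pmf M)"
    and "\<And>y. 0 \<le> measure_pmf.expectation M (\<lambda>x. of_bool (f x = y) * g x)"
  shows "0 \<le> measure_pmf.expectation M g"
  unfolding expectation_sum_fibres[OF assms(1), of g f] by (intro sum_nonneg assms(2))

lemma expectation_cong:
  fixes f g :: "'a \<Rightarrow> real"
  assumes "\<And>x. x \<in> set_pmf M \<Longrightarrow> f x = g x"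
  shows "measure_pmf.expectation M f = measure_pmf.expectation M g"
  using assms by (intro integral_cong_AE) (auto simp: AE_measure_pmf_iff)

text \<open>Fubini: over the finite support of \<open>M\<close> an expectation is a finite sum, so
  linearity suffices. \<open>N\<close> will be the adversary's own randomness.\<close>

lemma expectation_swap_finite:
  fixes f :: "'a \<Rightarrow> 'b \<Rightarrow> real"
  assumes fin: "finite (set_pmf M)" and bound: "\<And>x y. \<bar>f x y\<bar> \<le> B"
  shows "measure_pmf.expectation M (\<lambda>x. measure_pmf.expectation N (f x)) =
    measure_pmf.expectation N (\<lambda>y. measure_pmf.expectation M (\<lambda>x. f x y))"
proof -
  have sums: "measure_pmf.expectation M h = (\<Sum>x\<in>set_pmf M. pmf M x * h x)" for h :: "'a \<Rightarrow> real"
    using integral_measure_pmf[OF fin, of M h] by simp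
  show ?thesis
    unfolding sums
    by (subst Bochner_Integration.integral_sum)
       (auto intro!: integrable_mult_right integrable_pmf_bounded[where B = B] bound)
qed

lemma prob_cong_support:
  assumes "\<And>x. x \<in> set_pmf M \<Longrightarrow> x \<in> S \<longleftrightarrow> x \<in> T"
  shows "measure_pmf.prob M S = measure_pmf.prob M T"
  using assms by (intro measure_pmf.finite_measure_eq_AE) (auto simp: AE_measure_pmf_iff)

lemma prob_mono_support:
  assumes "\<And>x. x \<in> set_pmf M \<Longrightarrow> x \<in> S \<Longrightarrow> x \<in> T"
  shows "measure_pmf.prob M S \<le> measure_pmf.prob M T"
  using assms by (intro measure_pmf.finite_measure_mono_AE) (auto simp: AE_measure_pmf_iff)

lemma length_replicate_pmf: "xs \<in> set_pmf (replicate_pmf n p) \<Longrightarrow> length xs = n"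
  by (simp add: set_replicate_pmf)

lemma nth_replicate_pmf: "xs \<in> set_pmf (replicate_pmf n p) \<Longrightarrow> i < n \<Longrightarrow> xs ! i \<in> set_pmf p"
  by (auto simp: set_replicate_pmf lists_eq_set)

lemma finite_set_replicate_pmf:
  "finite (set_pmf p) \<Longrightarrow> finite (set_pmf (replicate_pmf n p))"
  by (induction n) auto

lemma replicate_pmf_Suc_snoc:
  "replicate_pmf (Suc n) p =
     bind_pmf (replicate_pmf n p) (\<lambda>xs. map_pmf (\<lambda>x. xs @ [x]) p)"
  using replicate_pmf_distrib[of n 1 p]
  by (simp add: map_pmf_def bind_assoc_pmf bind_return_pmf)

lemma butlast_replicate_pmf: "map_pmf butlast (replicate_pmf (Suc n) p) = replicate_pmf n p"
  unfolding replicate_pmf_Suc_snoc map_bind_pmf pmf.map_comp o_def by (simp add: bind_return_pmf')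

lemma replicate_map_pmf: "replicate_pmf n (map_pmf f p) = map_pmf (map f) (replicate_pmf n p)"
  by (induction n) (simp_all add: map_pmf_def bind_assoc_pmf bind_return_pmf)

text \<open>Independence of the coordinates, obtained by splitting off the head of the list.\<close>

lemma prob_replicate_pmf_cylinder:
  "measure_pmf.prob (replicate_pmf n p) {xs. \<forall>j<n. xs ! j \<in> S j} =
     (\<Prod>j<n. measure_pmf.prob p (S j))"
proof (induction n arbitrary: S)
  case (Suc n)
  have split: "(\<forall>j<Suc n. (x # xs) ! j \<in> S j) \<longleftrightarrow> x \<in> S 0 \<and> (\<forall>j<n. xs ! j \<in> S (Suc j))" for x xs
    by (auto simp: less_Suc_eq_0_disj)
  have "measure_pmf.prob (replicate_pmf (Suc n) p) {xs. \<forall>j<Suc n. xs ! j \<in> S j} =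
      measure_pmf.expectation p (\<lambda>x. measure_pmf.expectation (replicate_pmf n p)
        (\<lambda>xs. of_bool (x \<in> S 0 \<and> (\<forall>j<n. xs ! j \<in> S (Suc j)))))"
    unfolding expectation_of_bool[symmetric] replicate_pmf.simps
    by (subst expectation_bind_pmf_bounded[where B = 1],
        simp, subst expectation_bind_pmf_bounded[where B = 1])
       (simp_all only: expectation_return_pmf split abs_of_nonneg zero_less_eq_of_bool of_bool_less_eq_one)
  also have "\<dots> = measure_pmf.expectation p (\<lambda>x. of_bool (x \<in> S 0) *
      measure_pmf.prob (replicate_pmf n p) {xs. \<forall>j<n. xs ! j \<in> S (Suc j)})"
    by (simp only: of_bool_conj integral_mult_right_zero expectation_of_bool)
  also have "\<dots> = measure_pmf.prob p (S 0) * (\<Prod>j<n. measure_pmf.prob p (S (Suc j)))"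
    by (simp only: Suc integral_mult_left_zero expectation_of_bool Collect_mem_eq)
  finally show ?case by (simp only: prod.lessThan_Suc_shift)
qed simp

subsection \<open>Monotonicity of the collision probability\<close>

lemma collision_iff:
  "collision s \<longleftrightarrow> (\<exists>i j. i < length s \<and> j < length s \<and> i \<noteq> j \<and> output_ids (s ! i) \<inter> output_ids (s ! j) \<noteq> {})"
proof
  assume "collision s"
  then obtain i j where "i < j" "j < length s" "output_ids (s ! i) \<inter> output_ids (s ! j) \<noteq> {}"
    unfolding collision_def by blast
  then have "i < length s \<and> j < length s \<and> i \<noteq> j \<and> output_ids (s ! i) \<inter> output_ids (s ! j) \<noteq> {}"
    by simp
  then show "\<exists>i j. i < length s \<and> j < length s \<and> i \<noteq> j \<and> output_ids (s ! i) \<inter> output_ids (s ! j) \<noteq> {}"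
    by blast
next
  assume "\<exists>i j. i < length s \<and> j < length s \<and> i \<noteq> j \<and> output_ids (s ! i) \<inter> output_ids (s ! j) \<noteq> {}"
  then obtain i j where "i < length s" "j < length s" "i \<noteq> j"
    "output_ids (s ! i) \<inter> output_ids (s ! j) \<noteq> {}" by blast
  then show "collision s"
    unfolding collision_def using Int_commute[of "output_ids (s ! i)"]
    by (cases i j rule: linorder_cases) (metis, simp, metis)
qed

lemma output_ids_mono: "d \<le> d' \<Longrightarrow> output_ids (xs, d) \<subseteq> output_ids (xs, d')"
  by (simp add: output_ids_def set_take_subset_set_take)

text \<open>Output sets grow with the demands. The two lengths may differ so that both kinds of
  request are covered: a larger entry and an appended one.\<close>

lemma collision_zip_mono:
  assumes "length xss = length D" "length D \<le> length D'" "\<And>i. i < length D \<Longrightarrow> D ! i \<le> D' ! i"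
    and "collision (zip xss D)" "length xss' = length D'" "\<And>i. i < length D \<Longrightarrow> xss' ! i = xss ! i"
  shows "collision (zip xss' D')"
proof -
  obtain i j where "i < length (zip xss D)" "j < length (zip xss D)" "i \<noteq> j"
    "output_ids (zip xss D ! i) \<inter> output_ids (zip xss D ! j) \<noteq> {}"
    using assms(4) unfolding collision_iff by blast
  then have ij: "i < length D" "j < length D" "i \<noteq> j"
    "output_ids (xss ! i, D ! i) \<inter> output_ids (xss ! j, D ! j) \<noteq> {}"
    by (simp_all add: assms(1))
  have "output_ids (xss ! l, D ! l) \<subseteq> output_ids (xss' ! l, D' ! l)" if "l < length D" for l
    using that assms(3,6) by (simp add: output_ids_mono)
  then have "output_ids (xss' ! i, D' ! i) \<inter> output_ids (xss' ! j, D' ! j) \<noteq> {}"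
    using ij by blast
  moreover have "i < length D'" "j < length D'" using ij assms(2) by auto
  ultimately show ?thesis
    unfolding collision_iff using \<open>i \<noteq> j\<close> assms(5) by (intro exI[of _ i] exI[of _ j]) simp
qed

lemma collision_prob_mono:
  assumes "length D = length D'" "\<And>i. i < length D \<Longrightarrow> D ! i \<le> D' ! i"
  shows "collision_prob A D \<le> collision_prob A D'"
  unfolding collision_prob_def assms(1)[symmetric]
proof (rule prob_mono_support)
  fix xss assume "xss \<in> set_pmf (replicate_pmf (length D) A)" "xss \<in> {xss. collision (zip xss D)}"
  with assms collision_zip_mono[of xss D D' xss] show "xss \<in> {xss. collision (zip xss D')}"
    by (auto dest!: length_replicate_pmf)
qed

text \<open>Coupling: dropping the last of \<open>Suc n\<close> independent lists leaves
  \<open>n\<close> independent lists, so both probabilities can be compared on the longer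
  product.\<close>

lemma collision_prob_snoc: "collision_prob A D \<le> collision_prob A (D @ [d])"
proof -
  have "collision_prob A D =
      measure_pmf.prob (replicate_pmf (Suc (length D)) A) {xss. collision (zip (butlast xss) D)}"
    unfolding collision_prob_def
    by (subst butlast_replicate_pmf[symmetric]) (simp add: vimage_def del: replicate_pmf.simps)
  also have "\<dots> \<le> measure_pmf.prob (replicate_pmf (Suc (length D)) A) {xss. collision (zip xss (D @ [d]))}"
  proof (rule prob_mono_support)
    fix xss assume "xss \<in> set_pmf (replicate_pmf (Suc (length D)) A)"
      and "xss \<in> {xss. collision (zip (butlast xss) D)}"
    then have "length xss = Suc (length D)" "collision (zip (butlast xss) D)"
      by (auto simp del: replicate_pmf.simps dest: length_replicate_pmf)
    then have "collision (zip xss (D @ [d]))"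
      by (intro collision_zip_mono[of "butlast xss" D "D @ [d]" xss]) (auto simp: nth_append nth_butlast)
    then show "xss \<in> {xss. collision (zip xss (D @ [d]))}" by simp
  qed
  finally show ?thesis by (simp add: collision_prob_def del: replicate_pmf.simps)
qed

lemma collision_prob_request:
  assumes "(s', r) \<in> set_pmf (request A i s)"
  shows "collision_prob M (profile s) \<le> collision_prob M (profile s')"
proof (cases "i < length s")
  case True
  with assms have "s' = s[i := (fst (s ! i), snd (s ! i) + 1)]"
    by (auto simp: request_def Let_def)
  then show ?thesis
    using True by (auto simp: profile_def map_update nth_list_update intro!: collision_prob_mono)
next
  case False
  with assms obtain xs where "s' = s @ [(xs, 1)]" by (auto simp: request_def)
  then show ?thesis by (simp add: profile_def collision_prob_snoc)
qed

lemma interact_Request: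
  "interact A (Request i f) s =
    bind_pmf (request A i s) (\<lambda>(s', r). bind_pmf (f r) (\<lambda>Z. interact A Z s'))"
  by (simp add: bind_map_pmf)

lemma collision_prob_interact:
  assumes "s' \<in> set_pmf (interact A Z s)"
  shows "collision_prob M (profile s) \<le> collision_prob M (profile s')"
  using assms
proof (induction Z arbitrary: s)
  case (Request i f)
  then obtain s1 r Z where 1: "(s1, r) \<in> set_pmf (request A i s)" "Z \<in> set_pmf (f r)"
    "s' \<in> set_pmf (interact A Z s1)"
    by (auto simp: interact_Request simp del: interact.simps)
  have "collision_prob M (profile s1) \<le> collision_prob M (profile s')"
    using 1 by (intro Request.IH[of "f r"]) auto
  with collision_prob_request[OF 1(1), of M] show ?case by simp
qed simp

text \<open>Splits an activation into creating an idle instance with demand 0 and then requesting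
  from it, so that the analysis has to treat only requests to existing instances. Intermediate
  profiles may therefore contain 0.\<close>

lemma request_new_instance:
  assumes "length s \<le> i"
  shows "interact A (Request i f) s =
    bind_pmf A (\<lambda>xs. interact A (Request (length s) f) (s @ [(xs, 0)]))"
  using assms
  by (simp add: interact_Request request_def bind_map_pmf bind_return_pmf Let_def nth_append del: interact.simps)

subsection \<open>Adaptive adversaries against bin schemes\<close>

text \<open>
  \<open>P\<close> is the distribution of the sequence of bins of an instance, \<open>E\<close> lists the IDs of such a
  sequence, and \<open>nb d\<close> is the number of bins opened by the first \<open>d\<close> requests. The bin opened
  after \<open>e\<close> others is one of \<open>K e\<close>, all of which are equally likely unless already used; in the
  first \<open>l\<close> bins there are \<open>\<kappa> l e\<close> elements of \<open>K e\<close>.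
\<close>

locale bin_scheme =
  fixes P :: "'b list pmf" and E :: "'b list \<Rightarrow> nat list" and nb :: "nat \<Rightarrow> nat"
    and K :: "nat \<Rightarrow> 'b set" and \<kappa> :: "nat \<Rightarrow> nat \<Rightarrow> nat" and a :: "nat \<Rightarrow> real"
  assumes finite_P: "finite (set_pmf P)"
    and nb_0: "nb 0 = 0"
    and nb_Suc: "nb (Suc d) = nb d \<or> nb (Suc d) = Suc (nb d)"
    and answer_cong: "Bs \<in> set_pmf P \<Longrightarrow> Bs' \<in> set_pmf P \<Longrightarrow> 0 < d \<Longrightarrow>
      take (nb d) Bs = take (nb d) Bs' \<Longrightarrow> answer (E Bs, d) = answer (E Bs', d)"
    and output_ids_disjoint_iff: "Bs \<in> set_pmf P \<Longrightarrow> Bs' \<in> set_pmf P \<Longrightarrow>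
      output_ids (E Bs, d) \<inter> output_ids (E Bs', d') = {} \<longleftrightarrow>
      set (take (nb d) Bs) \<inter> set (take (nb d') Bs') = {}"
    and card_class: "Bs \<in> set_pmf P \<Longrightarrow> card (set (take l Bs) \<inter> K e) = \<kappa> l e"
    and a_nonneg: "0 \<le> a e"
    and next_bin: "Bs0 \<in> set_pmf P \<Longrightarrow> finite U \<Longrightarrow> U \<inter> set (take e Bs0) = {} \<Longrightarrow>
      measure_pmf.prob P {Bs. take e Bs = take e Bs0 \<and> set (take (Suc e) Bs) \<inter> U \<noteq> {}} =
      a e * real (card (U \<inter> K e)) * measure_pmf.prob P {Bs. take e Bs = take e Bs0}"
begin

section \<open>Collisions as common opened bins, and the collision hazard of a request\<close>

abbreviation A :: "nat list pmf" where "A \<equiv> map_pmf E P"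

abbreviation R :: "nat \<Rightarrow> 'b list list pmf" where "R n \<equiv> replicate_pmf n P"

abbreviation state_of :: "nat list \<Rightarrow> 'b list list \<Rightarrow> state" where
  "state_of D Bss \<equiv> zip (map E Bss) D"

text \<open>The information on which the analysis conditions. By \<open>answer_cong\<close> the
  opened bins determine every answer given so far, so the adversary knows at most this.\<close>

definition opened :: "nat list \<Rightarrow> 'b list list \<Rightarrow> 'b list list" where
  "opened D Bss = map2 (\<lambda>d Bs. take (nb d) Bs) D Bss"

definition overlap :: "'b list list \<Rightarrow> bool" where
  "overlap w \<longleftrightarrow> (\<exists>i j. i < length w \<and> j < length w \<and> i \<noteq> j \<and> set (w ! i) \<inter> set (w ! j) \<noteq> {})"

lemma finite_R: "finite (set_pmf (R n))"
  by (rule finite_set_replicate_pmf[OF finite_P])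

lemma length_opened: "length Bss = length D \<Longrightarrow> length (opened D Bss) = length D"
  by (simp add: opened_def)

lemma nth_opened:
  "length Bss = length D \<Longrightarrow> i < length D \<Longrightarrow> opened D Bss ! i = take (nb (D ! i)) (Bss ! i)"
  by (simp add: opened_def)

lemma nb_le_Suc: "nb d \<le> nb (Suc d)"
  using nb_Suc[of d] by auto

lemma collision_state_of:
  assumes "Bss \<in> set_pmf (R (length D))"
  shows "collision (state_of D Bss) \<longleftrightarrow> overlap (opened D Bss)"
proof -
  have len: "length Bss = length D" by (rule length_replicate_pmf[OF assms])
  have lens: "length (state_of D Bss) = length D" "length (opened D Bss) = length D"
    using len by (simp_all add: length_opened)
  have "output_ids (state_of D Bss ! i) \<inter> output_ids (state_of D Bss ! j) = {} \<longleftrightarrow>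
      set (opened D Bss ! i) \<inter> set (opened D Bss ! j) = {}"
    if "i < length D" "j < length D" for i j
    using that output_ids_disjoint_iff[OF nth_replicate_pmf[OF assms that(1)] nth_replicate_pmf[OF assms that(2)]]
    by (simp add: nth_opened len)
  then show ?thesis
    unfolding collision_iff overlap_def lens by blast
qed

lemma collision_prob_eq:
  "collision_prob A D = measure_pmf.prob (R (length D)) {Bss. overlap (opened D Bss)}"
proof -
  have "collision_prob A D = measure_pmf.prob (R (length D)) {Bss. collision (state_of D Bss)}"
    unfolding collision_prob_def replicate_map_pmf by (simp add: vimage_def)
  also have "\<dots> = measure_pmf.prob (R (length D)) {Bss. overlap (opened D Bss)}"
    by (rule prob_cong_support) (simp add: collision_state_of)
  finally show ?thesis .
qed

lemma opened_update:
  assumes "length Bss = length D" "i < length D"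
  shows "opened (D[i := d]) Bss = (opened D Bss)[i := take (nb d) (Bss ! i)]"
  by (rule nth_equalityI) (use assms in \<open>auto simp: length_opened nth_opened nth_list_update\<close>)

text \<open>Since \<open>nb\<close> is monotone, the bins opened before a request can be read off
  those opened after it: the fibres of the later profile refine those of the earlier one.\<close>

lemma opened_from_update:
  assumes "length Bss = length D" "i < length D"
  shows "opened D Bss = (opened (D[i := Suc (D ! i)]) Bss)
    [i := take (nb (D ! i)) (opened (D[i := Suc (D ! i)]) Bss ! i)]"
  by (rule nth_equalityI)
    (use assms nb_le_Suc[of "D ! i"] in \<open>auto simp: length_opened nth_opened nth_list_update min_absorb1\<close>)

text \<open>The point is that \<open>h\<close> does not depend on \<open>w\<close>, the bins that the adversary has seen.\<close>

lemma hazard: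
  assumes i: "i < length D"
  defines "D' \<equiv> D[i := Suc (D ! i)]"
  obtains h where "0 \<le> h" and "\<And>w. \<not> overlap w \<Longrightarrow>
    measure_pmf.prob (R (length D)) {Bss. opened D Bss = w \<and> overlap (opened D' Bss)} =
    h * measure_pmf.prob (R (length D)) {Bss. opened D Bss = w}"
proof (cases "nb (Suc (D ! i)) = nb (D ! i)")
  \<comment> \<open>No new bin is opened, so no overlap can arise and \<open>h = 0\<close>
    works.\<close>
  case True
  have "measure_pmf.prob (R (length D)) {Bss. opened D Bss = w \<and> overlap (opened D' Bss)} = 0"
    if "\<not> overlap w" for w
  proof -
    have "opened D' Bss = opened D Bss" if "length Bss = length D" for Bss
    proof -
      have "take (nb (Suc (D ! i))) (Bss ! i) = opened D Bss ! i"
        using that i by (simp add: True nth_opened)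
      then show ?thesis unfolding D'_def by (simp add: opened_update that i)
    qed
    then have "measure_pmf.prob (R (length D)) {Bss. opened D Bss = w \<and> overlap (opened D' Bss)} =
        measure_pmf.prob (R (length D)) {}"
      using that by (intro prob_cong_support) (auto dest: length_replicate_pmf)
    then show ?thesis by simp
  qed
  then show ?thesis by (intro that[of 0]) auto
next
  case False
  define n where "n = length D"
  define e where "e = nb (D ! i)"
  have e': "nb (Suc (D ! i)) = Suc e"
    using False nb_Suc[of "D ! i"] by (auto simp: e_def)
  define h where "h = a e * real (\<Sum>j\<in>{..<n} - {i}. \<kappa> (nb (D ! j)) e)"
  have "measure_pmf.prob (R n) {Bss. opened D Bss = w \<and> overlap (opened D' Bss)} =
      h * measure_pmf.prob (R n) {Bss. opened D Bss = w}" if w: "\<not> overlap w" for w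
  proof (cases "\<exists>Bss0\<in>set_pmf (R n). opened D Bss0 = w")
    case False
    then have "measure_pmf.prob (R n) {Bss. opened D Bss = w} = measure_pmf.prob (R n) {}"
      "measure_pmf.prob (R n) {Bss. opened D Bss = w \<and> overlap (opened D' Bss)} = measure_pmf.prob (R n) {}"
      by (intro prob_cong_support; auto)+
    then show ?thesis by simp
  next
    case True
    then obtain Bss0 where Bss0: "Bss0 \<in> set_pmf (R n)" and opened0: "opened D Bss0 = w" by blast
    have len0: "length Bss0 = length D"
      using length_replicate_pmf[OF Bss0] by (simp add: n_def)
    have wj: "w ! j = take (nb (D ! j)) (Bss0 ! j)" if "j < n" for j
      using that len0 by (simp add: opened0[symmetric] nth_opened n_def)
    have lw: "length w = n"
      using len0 by (simp add: opened0[symmetric] length_opened n_def)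
    have supp: "Bss0 ! j \<in> set_pmf P" if "j < n" for j
      using nth_replicate_pmf[OF Bss0 that] .
    have i_n: "i < n" using i by (simp add: n_def)
    have wi: "w ! i = take e (Bss0 ! i)" using wj[OF i_n] by (simp add: e_def)
    have disj: "set (w ! j) \<inter> set (w ! l) = {}" if "j < n" "l < n" "j \<noteq> l" for j l
      using w that lw by (auto simp: overlap_def)
    \<comment> \<open>The bins whose choice would cause a collision. As \<open>w\<close> has no
      overlap, they are disjoint from the bins of instance \<open>i\<close>, which
      \<open>next_bin\<close> requires, and the counts of the single instances add up.\<close>
    define U where "U = (\<Union>j\<in>{..<n} - {i}. set (w ! j))"
    have sub_U: "set (w ! j) \<subseteq> U" if "j < n" "j \<noteq> i" for j
      using that by (auto simp: U_def)
    have U_i: "U \<inter> set (take e (Bss0 ! i)) = {}"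
      unfolding U_def wi[symmetric] using disj[OF _ i_n] by blast
    have "U \<inter> K e = (\<Union>j\<in>{..<n} - {i}. set (w ! j) \<inter> K e)" by (auto simp: U_def)
    also have "card \<dots> = (\<Sum>j\<in>{..<n} - {i}. card (set (w ! j) \<inter> K e))"
      using disj by (intro card_UN_disjoint) auto
    also have "\<dots> = (\<Sum>j\<in>{..<n} - {i}. \<kappa> (nb (D ! j)) e)"
      by (intro sum.cong refl) (simp add: wj card_class supp)
    finally have card_U: "card (U \<inter> K e) = (\<Sum>j\<in>{..<n} - {i}. \<kappa> (nb (D ! j)) e)" .
    \<comment> \<open>\<open>S j\<close> is the event that instance \<open>j\<close> has opened
      \<open>w ! j\<close>, and \<open>T\<close> is the part of \<open>S i\<close> in which the next
      bin hits \<open>U\<close>. The two probabilities to be compared are thus products over the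
      instances that differ only in factor \<open>i\<close>.\<close>
    define S where "S = (\<lambda>j. {Bs. take (nb (D ! j)) Bs = w ! j})"
    define T where "T = {Bs. take e Bs = w ! i \<and> set (take (Suc e) Bs) \<inter> U \<noteq> {}}"
    have S_i: "S i = {Bs. take e Bs = take e (Bss0 ! i)}"
      by (simp add: S_def e_def wi)
    have "finite U" by (simp add: U_def)
    from next_bin[OF supp[OF i_n] this U_i]
    have T: "measure_pmf.prob P T = h * measure_pmf.prob P (S i)"
      unfolding T_def S_i h_def card_U[symmetric] wi .
    have "T \<subseteq> S i" by (auto simp: T_def S_i wi)
    have opened_iff: "opened D Bss = w \<longleftrightarrow> (\<forall>j<n. Bss ! j \<in> S j)" if "length Bss = n" for Bss
      using that lw by (auto simp: list_eq_iff_nth_eq length_opened nth_opened n_def S_def)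
    have overlap_iff: "overlap (opened D' Bss) \<longleftrightarrow> set (take (Suc e) (Bss ! i)) \<inter> U \<noteq> {}"
      if "length Bss = n" "opened D Bss = w" for Bss
    proof -
      have "opened D' Bss = w[i := take (Suc e) (Bss ! i)]"
        using that i e' by (simp add: D'_def opened_update n_def)
      moreover have "overlap (w[i := X]) \<longleftrightarrow> set X \<inter> U \<noteq> {}" for X
      proof
        assume "overlap (w[i := X])"
        then obtain j l where jl: "j < n" "l < n" "j \<noteq> l" "set (w[i := X] ! j) \<inter> set (w[i := X] ! l) \<noteq> {}"
          by (auto simp: overlap_def lw)
        then have "j = i \<or> l = i" using disj[of j l] by (auto simp: nth_list_update lw)
        then show "set X \<inter> U \<noteq> {}"
          using jl sub_U[of j] sub_U[of l] by (auto simp: nth_list_update lw) blast+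
      next
        assume "set X \<inter> U \<noteq> {}"
        then obtain j where "j < n" "j \<noteq> i" "set X \<inter> set (w ! j) \<noteq> {}" by (auto simp: U_def)
        then show "overlap (w[i := X])"
          unfolding overlap_def using i_n by (intro exI[of _ i] exI[of _ j]) (auto simp: lw)
      qed
      ultimately show ?thesis by simp
    qed
    have step_iff: "opened D Bss = w \<and> overlap (opened D' Bss) \<longleftrightarrow>
        (\<forall>j<n. Bss ! j \<in> (S(i := T)) j)" if "length Bss = n" for Bss
    proof -
      have "opened D Bss = w \<and> overlap (opened D' Bss) \<longleftrightarrow> opened D Bss = w \<and> Bss ! i \<in> T"
        using overlap_iff[OF that] opened_iff[OF that] i_n
        by (auto simp: T_def S_i wi)
      also have "\<dots> \<longleftrightarrow> (\<forall>j<n. Bss ! j \<in> (S(i := T)) j)"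
        unfolding opened_iff[OF that] using \<open>T \<subseteq> S i\<close> i_n by (auto simp: fun_upd_def)
      finally show ?thesis .
    qed
    have "measure_pmf.prob (R n) {Bss. opened D Bss = w \<and> overlap (opened D' Bss)} =
        measure_pmf.prob (R n) {Bss. \<forall>j<n. Bss ! j \<in> (S(i := T)) j}"
      by (rule prob_cong_support, unfold mem_Collect_eq, rule step_iff, erule length_replicate_pmf)
    also have "\<dots> = (\<Prod>j<n. measure_pmf.prob P ((S(i := T)) j))"
      by (rule prob_replicate_pmf_cylinder)
    also have "\<dots> = measure_pmf.prob P T * (\<Prod>j\<in>{..<n} - {i}. measure_pmf.prob P (S j))"
      using i_n by (subst prod.remove[of _ i]) auto
    also have "\<dots> = h * (\<Prod>j<n. measure_pmf.prob P (S j))"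
      using i_n by (subst (2) prod.remove[of _ i]) (auto simp: T)
    also have "(\<Prod>j<n. measure_pmf.prob P (S j)) = measure_pmf.prob (R n) {Bss. \<forall>j<n. Bss ! j \<in> S j}"
      by (rule prob_replicate_pmf_cylinder[symmetric])
    also have "\<dots> = measure_pmf.prob (R n) {Bss. opened D Bss = w}"
      by (rule prob_cong_support, unfold mem_Collect_eq, rule opened_iff[symmetric], erule length_replicate_pmf)
    finally show ?thesis .
  qed
  moreover have "0 \<le> h" by (simp add: h_def a_nonneg sum_nonneg)
  ultimately show ?thesis by (intro that[of h]) (simp_all add: n_def)
qed

section \<open>The value of a play and its behaviour under requests\<close>

abbreviation q :: "nat list \<Rightarrow> real" where "q \<equiv> collision_prob A"

definition gain :: "state \<Rightarrow> real" where
  "gain s = 2 * q (profile s) - of_bool (collision s)"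

definition play_value :: "adversary \<Rightarrow> state \<Rightarrow> real" where
  "play_value Z s = measure_pmf.expectation (interact A Z s) gain"

lemma q_bounds: "0 \<le> q D" "q D \<le> 1"
  by (simp_all add: collision_prob_def)

lemma abs_gain: "\<bar>gain s\<bar> \<le> 3"
  using q_bounds[of "profile s"] by (auto simp: gain_def of_bool_def)

lemma abs_play_value: "\<bar>play_value Z s\<bar> \<le> 3"
  unfolding play_value_def by (rule abs_expectation_le) (rule abs_gain)

lemma play_value_Stop: "play_value Stop s = gain s"
  by (simp add: play_value_def)

text \<open>\<open>q\<close> cannot decrease along a play, and a collision costs at most 1. This
  bound serves the states that already have an overlap, about which the induction hypothesis says
  nothing.\<close>

lemma play_value_ge: "2 * q (profile s) - 1 \<le> play_value Z s"
  unfolding play_value_def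
proof (rule expectation_ge_const[where B = 3], rule abs_gain)
  fix s' assume "s' \<in> set_pmf (interact A Z s)"
  then have "q (profile s) \<le> q (profile s')" by (rule collision_prob_interact)
  moreover have "2 * q (profile s') - 1 \<le> gain s'" by (simp add: gain_def)
  ultimately show "2 * q (profile s) - 1 \<le> gain s'" by simp
qed

lemma play_value_request:
  assumes "i < length s"
  shows "play_value (Request i f) s =
    measure_pmf.expectation (f (answer (fst (s ! i), Suc (snd (s ! i)))))
      (\<lambda>Z. play_value Z (s[i := (fst (s ! i), Suc (snd (s ! i)))]))"
proof -
  have "interact A (Request i f) s = bind_pmf (f (answer (fst (s ! i), Suc (snd (s ! i)))))
      (\<lambda>Z. interact A Z (s[i := (fst (s ! i), Suc (snd (s ! i)))]))"
    using assms by (simp add: interact_Request request_def Let_def bind_return_pmf del: interact.simps)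
  then show ?thesis
    by (simp add: play_value_def expectation_bind_pmf_bounded[where B = 3] abs_gain)
qed

lemma play_value_new_instance:
  assumes "length s \<le> i"
  shows "play_value (Request i f) s =
    measure_pmf.expectation P (\<lambda>Bs. play_value (Request (length s) f) (s @ [(E Bs, 0)]))"
  unfolding play_value_def request_new_instance[OF assms] bind_map_pmf
  by (rule expectation_bind_pmf_bounded) (rule abs_gain)

lemma profile_state_of: "length Bss = length D \<Longrightarrow> profile (state_of D Bss) = D"
  by (simp add: profile_def)

text \<open>Summing \<open>hazard\<close> over all \<open>w\<close> gives
  \<open>q D' - q D = h * (1 - q D)\<close>. In the fibre of \<open>w\<close>, of probability
  \<open>\<alpha>\<close>, the expectation is
  \<open>\<alpha> * ((q D' - q D) - h * (1 - q D'))\<close>, which equals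
  \<open>\<alpha> * h * (q D' - q D)\<close>.\<close>

lemma request_gain:
  assumes i: "i < length D" and w: "\<not> overlap w"
  defines "D' \<equiv> D[i := Suc (D ! i)]"
  shows "0 \<le> measure_pmf.expectation (R (length D)) (\<lambda>Bss. of_bool (opened D Bss = w) *
    ((if overlap (opened D' Bss) then 2 * q D' - 1 else q D') - q D))"
proof -
  let ?R = "R (length D)"
  obtain h where h: "0 \<le> h" and step: "\<And>w. \<not> overlap w \<Longrightarrow>
      measure_pmf.prob ?R {Bss. opened D Bss = w \<and> overlap (opened D' Bss)} =
      h * measure_pmf.prob ?R {Bss. opened D Bss = w}"
    using hazard[OF i] unfolding D'_def by blast
  note int = integrable_measure_pmf_finite[OF finite_R]
  have len: "length D' = length D" by (simp add: D'_def)
  \<comment> \<open>In a fibre without overlap the indicator of a new overlap integrates to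
    \<open>h\<close> times the mass of the fibre, by \<open>step\<close>. A fibre with overlap
    vanishes through the second factor.\<close>
  have "measure_pmf.expectation ?R (\<lambda>Bss. of_bool (opened D Bss = y) *
      (of_bool (\<not> overlap (opened D Bss)) * (of_bool (overlap (opened D' Bss)) - h))) = 0" for y
  proof (cases "overlap y")
    case True
    then have "(\<lambda>Bss. of_bool (opened D Bss = y) *
        (of_bool (\<not> overlap (opened D Bss)) * (of_bool (overlap (opened D' Bss)) - h))) = (\<lambda>_. 0)"
      by auto
    then show ?thesis by simp
  next
    case False
    then have "(\<lambda>Bss. of_bool (opened D Bss = y) *
        (of_bool (\<not> overlap (opened D Bss)) * (of_bool (overlap (opened D' Bss)) - h))) =
        (\<lambda>Bss. of_bool (opened D Bss = y \<and> overlap (opened D' Bss)) - h * of_bool (opened D Bss = y))"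
      by (auto simp: of_bool_def)
    then show ?thesis
      by (simp add: Bochner_Integration.integral_diff[OF int int] expectation_of_bool step[OF False])
  qed
  then have "measure_pmf.expectation ?R
      (\<lambda>Bss. of_bool (\<not> overlap (opened D Bss)) * (of_bool (overlap (opened D' Bss)) - h)) = 0"
    by (subst expectation_sum_fibres[OF finite_R, where f = "opened D"]) simp
  moreover have "measure_pmf.expectation ?R
      (\<lambda>Bss. of_bool (\<not> overlap (opened D Bss)) * (of_bool (overlap (opened D' Bss)) - h)) =
    measure_pmf.expectation ?R (\<lambda>Bss. of_bool (overlap (opened D' Bss)) - of_bool (overlap (opened D Bss))
        - h * (1 - of_bool (overlap (opened D Bss))))"
  proof (rule expectation_cong)
    fix Bss assume Bss: "Bss \<in> set_pmf ?R"
    \<comment> \<open>An overlap persists, so the indicator of a new overlap is a difference of two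
      indicators.\<close>
    have "overlap (opened D' Bss)" if "overlap (opened D Bss)"
    proof -
      have "collision (state_of D' Bss)"
        using that Bss len i
        by (intro collision_zip_mono[of "map E Bss" D D' "map E Bss"])
          (auto simp: collision_state_of D'_def nth_list_update dest: length_replicate_pmf)
      then show ?thesis using Bss by (simp add: collision_state_of len)
    qed
    then show "of_bool (\<not> overlap (opened D Bss)) * (of_bool (overlap (opened D' Bss)) - h) =
        of_bool (overlap (opened D' Bss)) - of_bool (overlap (opened D Bss))
        - h * (1 - of_bool (overlap (opened D Bss)))"
      by (auto simp: of_bool_def)
  qed
  moreover have "\<dots> = q D' - q D - h * (1 - q D)"
    by (simp add: Bochner_Integration.integral_diff[OF int int] expectation_of_bool collision_prob_eq len)
  ultimately have q_step: "q D' - q D = h * (1 - q D)" by simp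
  define \<alpha> where "\<alpha> = measure_pmf.prob ?R {Bss. opened D Bss = w}"
  have "(\<lambda>Bss. of_bool (opened D Bss = w) *
      ((if overlap (opened D' Bss) then 2 * q D' - 1 else q D') - q D)) =
    (\<lambda>Bss. (q D' - q D) * of_bool (opened D Bss = w)
      - (1 - q D') * of_bool (opened D Bss = w \<and> overlap (opened D' Bss)))"
    by (auto simp: of_bool_def)
  then have "measure_pmf.expectation ?R (\<lambda>Bss. of_bool (opened D Bss = w) *
      ((if overlap (opened D' Bss) then 2 * q D' - 1 else q D') - q D)) =
      (q D' - q D) * \<alpha> - (1 - q D') * (h * \<alpha>)"
    by (simp add: Bochner_Integration.integral_diff[OF int int] expectation_of_bool step[OF w] \<alpha>_def)
  also have "\<dots> = \<alpha> * h * (q D' - q D)"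
    unfolding q_step by (simp add: algebra_simps) (use q_step in algebra)
  also have "\<dots> \<ge> 0"
    unfolding q_step using h q_bounds[of D] by (simp add: \<alpha>_def)
  finally show ?thesis .
qed

text \<open>The induction invariant averages over the hidden bins within the fibre of
  \<open>w\<close>, because the inequality may fail for a single hidden state. The indicator
  replaces conditioning on the fibre, whose probability may be 0.\<close>

definition favourable :: "adversary \<Rightarrow> bool" where
  "favourable Z \<longleftrightarrow> (\<forall>D w. \<not> overlap w \<longrightarrow>
     0 \<le> measure_pmf.expectation (R (length D))
       (\<lambda>Bss. of_bool (opened D Bss = w) * (play_value Z (state_of D Bss) - q D)))"

lemma favourable_Stop: "favourable Stop"
  unfolding favourable_def
proof (intro allI impI)
  fix D w assume w: "\<not> overlap w"
  show "0 \<le> measure_pmf.expectation (R (length D))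
      (\<lambda>Bss. of_bool (opened D Bss = w) * (play_value Stop (state_of D Bss) - q D))"
  proof (intro integral_nonneg_AE, unfold AE_measure_pmf_iff, intro ballI)
    fix Bss assume Bss: "Bss \<in> set_pmf (R (length D))"
    then have "gain (state_of D Bss) = 2 * q D" if "opened D Bss = w"
      using that w by (simp add: gain_def profile_state_of length_replicate_pmf collision_state_of)
    then show "0 \<le> of_bool (opened D Bss = w) * (play_value Stop (state_of D Bss) - q D)"
      using q_bounds[of D] by (auto simp: play_value_Stop of_bool_def)
  qed
qed

text \<open>The difference between play value and \<open>q D\<close> is split at an intermediate
  bound \<open>b\<close> on the value after the request. That \<open>b\<close> is at least
  \<open>q D\<close> on average is \<open>request_gain\<close>. That the play is worth at least
  \<open>b\<close> on average is checked in each fibre of \<open>opened D'\<close>: by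
  \<open>play_value_ge\<close> if its bins overlap, by the induction hypothesis if not.\<close>

lemma favourable_old_instance:
  assumes IH: "\<And>Z r. Z \<in> set_pmf (f r) \<Longrightarrow> favourable Z"
    and i: "i < length D" and w: "\<not> overlap w"
  shows "0 \<le> measure_pmf.expectation (R (length D))
    (\<lambda>Bss. of_bool (opened D Bss = w) * (play_value (Request i f) (state_of D Bss) - q D))"
proof -
  define D' where "D' = D[i := Suc (D ! i)]"
  have len: "length D' = length D" by (simp add: D'_def)
  let ?R = "R (length D)"
  define b where "b = (\<lambda>Bss. if overlap (opened D' Bss) then 2 * q D' - 1 else q D')"
  have step_value: "play_value (Request i f) (state_of D Bss) =
      measure_pmf.expectation (f (answer (E (Bss ! i), Suc (D ! i)))) (\<lambda>Z. play_value Z (state_of D' Bss))"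
    if "Bss \<in> set_pmf ?R" for Bss
  proof -
    have lenB: "length Bss = length D" using that by (rule length_replicate_pmf)
    have nth: "state_of D Bss ! i = (E (Bss ! i), D ! i)" using lenB i by simp
    have upd: "(state_of D Bss)[i := (E (Bss ! i), Suc (D ! i))] = state_of D' Bss"
      by (rule nth_equalityI) (use lenB i in \<open>auto simp: nth_list_update D'_def\<close>)
    have "i < length (state_of D Bss)" using lenB i by simp
    from play_value_request[OF this] show ?thesis by (simp only: nth upd fst_conv snd_conv)
  qed
  have "0 \<le> measure_pmf.expectation ?R (\<lambda>Bss. of_bool (opened D' Bss = y) *
      (of_bool (opened D Bss = w) * (play_value (Request i f) (state_of D Bss) - b Bss)))" for y
  proof (cases "overlap y")
    case True
    show ?thesis
    proof (intro integral_nonneg_AE, unfold AE_measure_pmf_iff, intro ballI)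
      fix Bss assume Bss: "Bss \<in> set_pmf ?R"
      have "2 * q D' - 1 \<le> play_value (Request i f) (state_of D Bss)"
        unfolding step_value[OF Bss]
        by (rule expectation_ge_const[OF abs_play_value])
          (use play_value_ge[of "state_of D' Bss"] Bss in
            \<open>simp add: profile_state_of length_replicate_pmf len\<close>)
      then show "0 \<le> of_bool (opened D' Bss = y) *
          (of_bool (opened D Bss = w) * (play_value (Request i f) (state_of D Bss) - b Bss))"
        using True by (auto simp: b_def of_bool_def)
    qed
  next
    case no_overlap: False
    show ?thesis
    \<comment> \<open>An empty intersection with the fibre of \<open>w\<close> contributes 0;
      otherwise a representative \<open>Bss0\<close> is available to name the answer.\<close>
    proof (cases "\<exists>Bss0\<in>set_pmf ?R. opened D' Bss0 = y \<and> opened D Bss0 = w")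
      case False
      then have "measure_pmf.expectation ?R (\<lambda>Bss. of_bool (opened D' Bss = y) *
          (of_bool (opened D Bss = w) * (play_value (Request i f) (state_of D Bss) - b Bss))) =
          measure_pmf.expectation ?R (\<lambda>_. 0)"
        by (intro expectation_cong) auto
      then show ?thesis by simp
    next
      case True
      then obtain Bss0 where Bss0: "Bss0 \<in> set_pmf ?R" "opened D' Bss0 = y" "opened D Bss0 = w" by blast
      \<comment> \<open>All bin sequences of the fibre give the same answer to this request, so the
        adversary continues with one distribution \<open>N\<close> that does not depend on the
        hidden bins.\<close>
      define N where "N = f (answer (E (Bss0 ! i), Suc (D ! i)))"
      have "of_bool (opened D' Bss = y) *
          (of_bool (opened D Bss = w) * (play_value (Request i f) (state_of D Bss) - b Bss)) =
        measure_pmf.expectation N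
          (\<lambda>Z. of_bool (opened D' Bss = y) * (play_value Z (state_of D' Bss) - q D'))"
        if Bss: "Bss \<in> set_pmf ?R" for Bss
      proof (cases "opened D' Bss = y")
        case True
        have lens: "length Bss = length D" "length Bss0 = length D"
          using Bss Bss0(1) by (auto dest: length_replicate_pmf)
        have "opened D Bss = opened D Bss0"
          using opened_from_update[OF lens(1) i] opened_from_update[OF lens(2) i] True Bss0(2)
          by (simp add: D'_def)
        moreover have "answer (E (Bss ! i), Suc (D ! i)) = answer (E (Bss0 ! i), Suc (D ! i))"
        proof (rule answer_cong)
          have "opened D' Bss ! i = opened D' Bss0 ! i" using True Bss0(2) by simp
          then show "take (nb (Suc (D ! i))) (Bss ! i) = take (nb (Suc (D ! i))) (Bss0 ! i)"
            using lens i by (simp add: nth_opened len) (simp add: D'_def)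
        qed (use Bss Bss0(1) i in \<open>auto intro: nth_replicate_pmf\<close>)
        ultimately show ?thesis
          using True no_overlap Bss0(3)
          by (simp add: step_value[OF Bss] b_def N_def Bochner_Integration.integral_diff
              integrable_pmf_bounded[OF abs_play_value])
      qed simp
      then have "measure_pmf.expectation ?R (\<lambda>Bss. of_bool (opened D' Bss = y) *
          (of_bool (opened D Bss = w) * (play_value (Request i f) (state_of D Bss) - b Bss))) =
        measure_pmf.expectation ?R (\<lambda>Bss. measure_pmf.expectation N
          (\<lambda>Z. of_bool (opened D' Bss = y) * (play_value Z (state_of D' Bss) - q D')))"
        by (rule expectation_cong)
      \<comment> \<open>Exchanging the expectations fixes the continuation \<open>Z\<close> first,
        and the induction hypothesis applies to each \<open>Z\<close> separately.\<close>
      also have "\<dots> = measure_pmf.expectation N (\<lambda>Z. measure_pmf.expectation ?R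
          (\<lambda>Bss. of_bool (opened D' Bss = y) * (play_value Z (state_of D' Bss) - q D')))"
      proof (rule expectation_swap_finite[OF finite_R, where B = 4])
        fix Bss Z
        show "\<bar>of_bool (opened D' Bss = y) * (play_value Z (state_of D' Bss) - q D')\<bar> \<le> 4"
          using abs_play_value[of Z "state_of D' Bss"] q_bounds[of D'] by (auto simp: of_bool_def)
      qed
      also have "\<dots> \<ge> 0"
      proof (intro integral_nonneg_AE, unfold AE_measure_pmf_iff, intro ballI)
        fix Z assume "Z \<in> set_pmf N"
        then have "favourable Z" using IH by (simp add: N_def)
        then show "0 \<le> measure_pmf.expectation ?R
            (\<lambda>Bss. of_bool (opened D' Bss = y) * (play_value Z (state_of D' Bss) - q D'))"
          using no_overlap unfolding favourable_def len[symmetric] by blast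
      qed
      finally show ?thesis .
    qed
  qed
  then have "0 \<le> measure_pmf.expectation ?R
      (\<lambda>Bss. of_bool (opened D Bss = w) * (play_value (Request i f) (state_of D Bss) - b Bss))"
    by (rule expectation_nonneg_by_fibres[OF finite_R])
  moreover have "0 \<le> measure_pmf.expectation ?R (\<lambda>Bss. of_bool (opened D Bss = w) * (b Bss - q D))"
    unfolding b_def D'_def by (rule request_gain[OF i w])
  moreover have "measure_pmf.expectation ?R
      (\<lambda>Bss. of_bool (opened D Bss = w) * (play_value (Request i f) (state_of D Bss) - q D)) =
    measure_pmf.expectation ?R
      (\<lambda>Bss. of_bool (opened D Bss = w) * (play_value (Request i f) (state_of D Bss) - b Bss)) +
    measure_pmf.expectation ?R (\<lambda>Bss. of_bool (opened D Bss = w) * (b Bss - q D))"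
    by (subst Bochner_Integration.integral_add[symmetric])
      (auto intro!: integrable_measure_pmf_finite finite_R expectation_cong simp: algebra_simps)
  ultimately show ?thesis by simp
qed

section \<open>Activation of instances and the bound for all adversaries\<close>

lemma opened_idle_instance:
  "length Bss = length D \<Longrightarrow> opened (D @ [0]) (Bss @ [Bs]) = opened D Bss @ [[]]"
  by (simp add: opened_def nb_0)

lemma overlap_idle_instance: "overlap (w @ [[]]) \<longleftrightarrow> overlap w"
  unfolding overlap_def by (auto simp: nth_append less_Suc_eq)

text \<open>An idle instance has opened no bin and cannot collide, so its bin sequence can be
  integrated out.\<close>

lemma q_idle_instance: "q (D @ [0]) = q D"
proof -
  have "q D = measure_pmf.prob (R (Suc (length D))) {Bss. overlap (opened D (butlast Bss))}"
    unfolding collision_prob_eq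
    by (subst butlast_replicate_pmf[symmetric]) (simp add: vimage_def del: replicate_pmf.simps)
  also have "\<dots> = measure_pmf.prob (R (Suc (length D))) {Bss. overlap (opened (D @ [0]) Bss)}"
  proof (rule prob_cong_support)
    fix Bss assume "Bss \<in> set_pmf (R (Suc (length D)))"
    then obtain Cs C where "Bss = Cs @ [C]" "length Cs = length D"
      by (auto dest!: length_replicate_pmf simp: length_Suc_conv_rev simp del: replicate_pmf.simps)
    then show "Bss \<in> {Bss. overlap (opened D (butlast Bss))} \<longleftrightarrow>
        Bss \<in> {Bss. overlap (opened (D @ [0]) Bss)}"
      by (simp add: opened_idle_instance overlap_idle_instance)
  qed
  finally show ?thesis by (simp add: collision_prob_eq del: replicate_pmf.simps)
qed

text \<open>Structural induction on the decision tree. An activation is a request to the last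
  instance of \<open>D @ [0]\<close>, averaged over the bin sequence drawn for it.\<close>

lemma favourable_all: "favourable Z"
proof (induction Z)
  case Stop
  show ?case by (rule favourable_Stop)
next
  case (Request i f)
  have IH: "favourable Z" if "Z \<in> set_pmf (f r)" for Z r
    using that by (intro Request.IH[of "f r"]) auto
  show ?case
    unfolding favourable_def
  proof (intro allI impI)
    fix D w assume w: "\<not> overlap w"
    show "0 \<le> measure_pmf.expectation (R (length D))
        (\<lambda>Bss. of_bool (opened D Bss = w) * (play_value (Request i f) (state_of D Bss) - q D))"
    proof (cases "i < length D")
      case True
      then show ?thesis using w by (intro favourable_old_instance IH)
    next
      case False
      \<comment> \<open>The integrand for the profile with an idle instance. The index
        \<open>i\<close> becomes \<open>length D\<close>, as any index beyond the active instances
        activates exactly one.\<close>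
      let ?n = "length D" and ?g = "\<lambda>Bss. of_bool (opened (D @ [0]) Bss = w @ [[]]) *
        (play_value (Request (length D) f) (state_of (D @ [0]) Bss) - q (D @ [0]))"
      have "0 \<le> measure_pmf.expectation (R (Suc ?n)) ?g"
        using favourable_old_instance[OF IH, where i = "length D" and D = "D @ [0]" and w = "w @ [[]]"] w
        by (simp add: overlap_idle_instance del: replicate_pmf.simps)
      also have "\<dots> = measure_pmf.expectation (R ?n) (\<lambda>Bss. measure_pmf.expectation P (\<lambda>Bs. ?g (Bss @ [Bs])))"
        unfolding replicate_pmf_Suc_snoc
      proof (subst expectation_bind_pmf_bounded[where B = 4])
        fix Bss
        show "\<bar>?g Bss\<bar> \<le> 4"
          using abs_play_value[of "Request ?n f" "state_of (D @ [0]) Bss"] q_bounds[of "D @ [0]"]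
          by (auto simp: of_bool_def)
      qed simp
      also have "\<dots> = measure_pmf.expectation (R ?n)
          (\<lambda>Bss. of_bool (opened D Bss = w) * (play_value (Request i f) (state_of D Bss) - q D))"
      proof (rule expectation_cong)
        fix Bss assume "Bss \<in> set_pmf (R ?n)"
        then have l: "length Bss = length D" by (rule length_replicate_pmf)
        have "?g (Bss @ [Bs]) = of_bool (opened D Bss = w) *
            (play_value (Request ?n f) (state_of D Bss @ [(E Bs, 0)]) - q D)" for Bs
          using l by (simp add: opened_idle_instance q_idle_instance)
        then have "measure_pmf.expectation P (\<lambda>Bs. ?g (Bss @ [Bs])) = of_bool (opened D Bss = w) *
            (measure_pmf.expectation P (\<lambda>Bs. play_value (Request ?n f) (state_of D Bss @ [(E Bs, 0)])) - q D)"
          by (simp add: Bochner_Integration.integral_diff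
              [OF integrable_measure_pmf_finite[OF finite_P] integrable_measure_pmf_finite[OF finite_P]])
        also have "measure_pmf.expectation P (\<lambda>Bs. play_value (Request ?n f) (state_of D Bss @ [(E Bs, 0)])) =
            play_value (Request i f) (state_of D Bss)"
          using False l by (subst play_value_new_instance[of _ i]) auto
        finally show "measure_pmf.expectation P (\<lambda>Bs. ?g (Bss @ [Bs])) =
            of_bool (opened D Bss = w) * (play_value (Request i f) (state_of D Bss) - q D)" .
      qed
      finally show ?thesis .
    qed
  qed
qed

text \<open>At the empty profile there is a single fibre, in which \<open>favourable\<close> says
  that the value of the play is at least \<open>q []\<close>, hence nonnegative.\<close>

lemma adv_collision_prob_le:
  "adv_collision_prob A Z \<le> 2 * measure_pmf.expectation (final_profile A Z) q"
proof -
  have "overlap [] = False" by (simp add: overlap_def)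
  then have "0 \<le> measure_pmf.expectation (R (length []))
      (\<lambda>Bss. of_bool (opened [] Bss = []) * (play_value Z (state_of [] Bss) - q []))"
    using favourable_all[of Z, unfolded favourable_def, rule_format, of "[]" "[]"] by simp
  then have "q [] \<le> play_value Z []" by (simp add: opened_def)
  then have "0 \<le> play_value Z []" using q_bounds[of "[]"] by simp
  also have "play_value Z [] = 2 * measure_pmf.expectation (final_profile A Z) q - adv_collision_prob A Z"
    unfolding play_value_def gain_def final_profile_def adv_collision_prob_def
    by (subst Bochner_Integration.integral_diff)
      (auto simp: expectation_of_bool q_bounds intro!: integrable_mult_right integrable_pmf_bounded[where B = 1])
  finally show ?thesis by simp
qed

end

subsection \<open>Concatenations of bins\<close>

text \<open>Provides the part of \<open>bin_scheme\<close> that concerns IDs. The tail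
  \<open>T\<close> holds the leftover IDs, which belong to no bin; \<open>tail_common\<close> makes
  them harmless, for two instances that reach the tail have opened all their bins and so already
  share one.\<close>

locale bin_layout =
  fixes P :: "nat set list pmf" and L :: nat and sz :: "nat \<Rightarrow> nat" and T :: "nat list"
  assumes length_bins: "Bs \<in> set_pmf P \<Longrightarrow> length Bs = L"
    and card_bin: "Bs \<in> set_pmf P \<Longrightarrow> t < L \<Longrightarrow> card (Bs ! t) = sz t"
    and sz_pos: "t < L \<Longrightarrow> 0 < sz t"
    and bins_disjoint: "Bs \<in> set_pmf P \<Longrightarrow> Bs' \<in> set_pmf P \<Longrightarrow> B \<in> set Bs \<Longrightarrow> B' \<in> set Bs' \<Longrightarrow>
      B \<noteq> B' \<Longrightarrow> B \<inter> B' = {}"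
    and tail_disjoint: "Bs \<in> set_pmf P \<Longrightarrow> B \<in> set Bs \<Longrightarrow> B \<inter> set T = {}"
    and tail_common: "T \<noteq> [] \<Longrightarrow> Bs \<in> set_pmf P \<Longrightarrow> Bs' \<in> set_pmf P \<Longrightarrow> set Bs \<inter> set Bs' \<noteq> {}"
begin

definition ids :: "nat set list \<Rightarrow> nat list" where
  "ids Bs = concat (map sorted_list_of_set Bs) @ T"

definition offset :: "nat \<Rightarrow> nat" where
  "offset t = (\<Sum>u<t. sz u)"

text \<open>Bin \<open>t\<close>, counted from 0, is opened by request \<open>offset t + 1\<close>.
  Once \<open>L\<close> bins are open the value stays at \<open>L\<close>, also for requests served
  from the tail or left unanswered.\<close>

definition num_opened :: "nat \<Rightarrow> nat" where
  "num_opened d = (LEAST t. \<not> (t < L \<and> offset t < d))"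

lemma offset_mono: "s \<le> t \<Longrightarrow> offset s \<le> offset t"
  unfolding offset_def by (intro sum_mono2) auto

lemma less_num_opened_iff: "t < num_opened d \<longleftrightarrow> t < L \<and> offset t < d"
proof
  assume "t < num_opened d"
  then show "t < L \<and> offset t < d"
    unfolding num_opened_def using not_less_Least by blast
next
  assume t: "t < L \<and> offset t < d"
  have "\<not> (num_opened d < L \<and> offset (num_opened d) < d)"
    unfolding num_opened_def by (rule LeastI[of _ L]) simp
  then show "t < num_opened d"
    using t offset_mono[of "num_opened d" t] by (meson le_less_trans not_le)
qed

lemma num_opened_le: "num_opened d \<le> L"
  using less_num_opened_iff[of L d] by (simp add: not_less[symmetric])

lemma num_opened_0: "num_opened 0 = 0"
  using less_num_opened_iff[of 0 0] by simp

lemma num_opened_Suc: "num_opened (Suc d) = num_opened d \<or> num_opened (Suc d) = Suc (num_opened d)"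
proof -
  have "num_opened d \<le> num_opened (Suc d)"
    using less_num_opened_iff[of "num_opened (Suc d)" d]
      less_num_opened_iff[of "num_opened (Suc d)" "Suc d"] by linarith
  moreover have "\<not> Suc (num_opened d) < num_opened (Suc d)"
  proof
    assume "Suc (num_opened d) < num_opened (Suc d)"
    then have *: "Suc (num_opened d) < L" "offset (Suc (num_opened d)) < Suc d"
      by (simp_all add: less_num_opened_iff)
    \<comment> \<open>Bin sizes are positive, so two successive bins cannot both be opened by the
      same request.\<close>
    then have "offset (num_opened d) < d"
      using sz_pos[of "num_opened d"] by (simp add: offset_def)
    then show False using * less_num_opened_iff[of "num_opened d" d] by simp
  qed
  ultimately show ?thesis by linarith
qed

lemma finite_bin: "Bs \<in> set_pmf P \<Longrightarrow> t < L \<Longrightarrow> finite (Bs ! t)"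
  using card_bin sz_pos card.infinite by fastforce

lemma length_concat_take:
  assumes "Bs \<in> set_pmf P" "t \<le> L"
  shows "length (concat (map sorted_list_of_set (take t Bs))) = offset t"
  using assms(2)
proof (induction t)
  case (Suc t)
  then show ?case
    using assms(1) by (simp add: take_Suc_conv_app_nth length_bins card_bin offset_def)
qed (simp add: offset_def)

lemma length_ids: "Bs \<in> set_pmf P \<Longrightarrow> length (ids Bs) = offset L + length T"
  using length_concat_take[of Bs L] by (simp add: ids_def length_bins)

text \<open>If a bin is still closed, the first \<open>d\<close> positions lie inside the opened
  bins, whatever follows them; the tail can matter only after all \<open>L\<close> bins.\<close>

lemma take_ids:
  assumes "Bs \<in> set_pmf P"
  shows "take d (ids Bs) = take d (concat (map sorted_list_of_set (take (num_opened d) Bs)) @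
    (if num_opened d = L then T else []))"
proof (cases "num_opened d = L")
  case True
  then show ?thesis using assms by (simp add: ids_def length_bins)
next
  case False
  then have "num_opened d < L" using num_opened_le[of d] by simp
  then have d: "d \<le> offset (num_opened d)"
    using less_num_opened_iff[of "num_opened d" d] by simp
  have "ids Bs = concat (map sorted_list_of_set (take (num_opened d) Bs)) @
      concat (map sorted_list_of_set (drop (num_opened d) Bs)) @ T"
    unfolding ids_def by (simp flip: concat_append map_append append_assoc)
  then show ?thesis
    using d False by (simp add: length_concat_take[OF assms num_opened_le])
qed

text \<open>The returned prefix is a function of the opened bins, and all ID lists have the same
  length, so exhaustion occurs at the same request for both sequences.\<close>

lemma answer_cong:
  assumes "Bs \<in> set_pmf P" "Bs' \<in> set_pmf P" "0 < d"
    and "take (num_opened d) Bs = take (num_opened d) Bs'"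
  shows "answer (ids Bs, d) = answer (ids Bs', d)"
proof -
  have "take d (ids Bs) = take d (ids Bs')"
    using assms by (simp add: take_ids)
  then have "ids Bs ! (d - 1) = ids Bs' ! (d - 1)"
    using \<open>0 < d\<close> by (metis diff_less nth_take zero_less_one)
  then show ?thesis
    using assms by (simp add: answer_def length_ids)
qed

lemma ids_in_opened:
  assumes Bs: "Bs \<in> set_pmf P" and x: "x \<in> output_ids (ids Bs, d)"
  obtains B where "B \<in> set (take (num_opened d) Bs)" "x \<in> B" | "x \<in> set T" "take (num_opened d) Bs = Bs"
proof -
  have "x \<in> set (concat (map sorted_list_of_set (take (num_opened d) Bs)) @
      (if num_opened d = L then T else []))"
    using x unfolding output_ids_def by (auto simp: take_ids[OF Bs] dest: in_set_takeD)
  then consider "x \<in> set (concat (map sorted_list_of_set (take (num_opened d) Bs)))"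
    | "x \<in> set T" "num_opened d = L"
    by (auto split: if_splits)
  then show ?thesis
  proof cases
    case 1
    then obtain B where B: "B \<in> set (take (num_opened d) Bs)" "x \<in> set (sorted_list_of_set B)" by auto
    then have "finite B"
      using finite_bin[OF Bs] length_bins[OF Bs] by (auto simp: in_set_conv_nth dest!: in_set_takeD)
    then show ?thesis using B that(1) by simp
  next
    case 2
    then show ?thesis using that(2) length_bins[OF Bs] by simp
  qed
qed

text \<open>An opened bin has already delivered its least ID, as bins are read in increasing order.
  Two instances with a common opened bin therefore share this ID even if both have used the bin only
  in part.\<close>

lemma Min_opened:
  assumes Bs: "Bs \<in> set_pmf P" and B: "B \<in> set (take (num_opened d) Bs)"
  shows "sorted_list_of_set B ! 0 \<in> output_ids (ids Bs, d)"
proof -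
  obtain t where t: "t < num_opened d" "B = Bs ! t"
    using B by (auto simp: in_set_conv_nth)
  then have tL: "t < L" "offset t < d" by (simp_all add: less_num_opened_iff)
  have "Bs = take t Bs @ B # drop (Suc t) Bs"
    using id_take_nth_drop[of t Bs] tL t length_bins[OF Bs] by simp
  then have "ids Bs = concat (map sorted_list_of_set (take t Bs)) @ sorted_list_of_set B @
      (concat (map sorted_list_of_set (drop (Suc t) Bs)) @ T)"
    unfolding ids_def by (metis (no_types, lifting) append_assoc concat.simps(2) concat_append
        list.simps(9) map_append)
  moreover have "0 < length (sorted_list_of_set B)"
    using card_bin[OF Bs tL(1)] sz_pos[OF tL(1)] t by simp
  moreover have "length (concat (map sorted_list_of_set (take t Bs))) = offset t"
    using length_concat_take[OF Bs] tL by simp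
  ultimately have "ids Bs ! offset t = sorted_list_of_set B ! 0" "offset t < length (ids Bs)"
    by (simp_all add: nth_append)
  then show ?thesis
    unfolding output_ids_def using tL(2) by (auto simp: in_set_conv_nth intro!: exI[of _ "offset t"])
qed

text \<open>A common bin yields a common least ID. Conversely, a common ID lies either in one bin of
  each instance, which disjointness makes the same bin, or in the tail of both, and then
  \<open>tail_common\<close> provides a common bin.\<close>

lemma output_ids_disjoint_iff:
  assumes "Bs \<in> set_pmf P" "Bs' \<in> set_pmf P"
  shows "output_ids (ids Bs, d) \<inter> output_ids (ids Bs', d') = {} \<longleftrightarrow>
    set (take (num_opened d) Bs) \<inter> set (take (num_opened d') Bs') = {}"
proof
  assume "output_ids (ids Bs, d) \<inter> output_ids (ids Bs', d') = {}"
  then show "set (take (num_opened d) Bs) \<inter> set (take (num_opened d') Bs') = {}"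
    using Min_opened[OF assms(1)] Min_opened[OF assms(2)] by blast
next
  assume disj: "set (take (num_opened d) Bs) \<inter> set (take (num_opened d') Bs') = {}"
  show "output_ids (ids Bs, d) \<inter> output_ids (ids Bs', d') = {}"
  proof (rule ccontr)
    assume "output_ids (ids Bs, d) \<inter> output_ids (ids Bs', d') \<noteq> {}"
    then obtain x where x: "x \<in> output_ids (ids Bs, d)" "x \<in> output_ids (ids Bs', d')" by blast
    show False
    proof (rule ids_in_opened[OF assms(1) x(1)])
      fix B assume B: "B \<in> set (take (num_opened d) Bs)" "x \<in> B"
      show False
      proof (rule ids_in_opened[OF assms(2) x(2)])
        fix B' assume B': "B' \<in> set (take (num_opened d') Bs')" "x \<in> B'"
        then have "B = B'"
          using bins_disjoint[OF assms, of B B'] B by (meson disjoint_iff in_set_takeD)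
        then show False using B B' disj by blast
      next
        assume "x \<in> set T"
        then show False using tail_disjoint[OF assms(1), of B] B by (meson disjoint_iff in_set_takeD)
      qed
    next
      assume T: "x \<in> set T" "take (num_opened d) Bs = Bs"
      show False
      proof (rule ids_in_opened[OF assms(2) x(2)])
        fix B' assume "B' \<in> set (take (num_opened d') Bs')" "x \<in> B'"
        then show False using tail_disjoint[OF assms(2), of B'] T by (meson disjoint_iff in_set_takeD)
      next
        assume "x \<in> set T" "take (num_opened d') Bs' = Bs'"
        moreover have "T \<noteq> []" using T(1) by auto
        ultimately show False using T(2) disj tail_common[OF _ assms] by simp
      qed
    qed
  qed
qed

lemma set_ids:
  assumes Bs: "Bs \<in> set_pmf P"
  shows "set (ids Bs) = \<Union>(set Bs) \<union> set T"
proof -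
  have "finite B" if "B \<in> set Bs" for B
    using that finite_bin[OF Bs] length_bins[OF Bs] by (auto simp: in_set_conv_nth)
  then show ?thesis by (auto simp: ids_def)
qed

lemma distinct_ids:
  assumes "Bs \<in> set_pmf P" "distinct Bs" "distinct T"
  shows "distinct (ids Bs)"
proof -
  have fin: "finite B" "B \<noteq> {}" if "B \<in> set Bs" for B
    using that finite_bin[OF assms(1)] card_bin[OF assms(1)] sz_pos length_bins[OF assms(1)]
    by (fastforce simp: in_set_conv_nth)+
  have "inj_on sorted_list_of_set (set Bs)"
    using fin by (intro inj_onI) (metis set_sorted_list_of_set)
  then have "distinct (concat (map sorted_list_of_set Bs))"
    using assms fin bins_disjoint[OF assms(1,1)]
    by (intro distinct_concat) (auto simp: distinct_map, (metis disjoint_iff set_sorted_list_of_set)+)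
  then show ?thesis
    using assms fin tail_disjoint[OF assms(1)] by (auto simp: ids_def)
qed

end

subsection \<open>The algorithm \<open>Bins(k)\<close>\<close>

lemma permutations_with_prefix:
  assumes "finite X" "distinct v" "set v \<subseteq> X"
  shows "{xs \<in> permutations_of_set X. take (length v) xs = v} = (@) v ` permutations_of_set (X - set v)"
proof (intro equalityI subsetI)
  fix xs assume "xs \<in> {xs \<in> permutations_of_set X. take (length v) xs = v}"
  then have xs: "set xs = X" "distinct xs" "take (length v) xs = v"
    by (auto simp: permutations_of_set_def)
  have split: "xs = v @ drop (length v) xs"
    using append_take_drop_id[of "length v" xs] xs(3) by simp
  then have "distinct (v @ drop (length v) xs)" "set (v @ drop (length v) xs) = X"
    using xs by simp_all
  then have "drop (length v) xs \<in> permutations_of_set (X - set v)"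
    by (auto simp: permutations_of_set_def)
  with split show "xs \<in> (@) v ` permutations_of_set (X - set v)" by blast
qed (use assms in \<open>auto simp: permutations_of_set_def\<close>)

lemma card_permutations_with_prefix:
  assumes "finite X" "distinct v" "set v \<subseteq> X"
  shows "card {xs \<in> permutations_of_set X. take (length v) xs = v} = fact (card X - length v)"
  using assms
  by (simp add: permutations_with_prefix card_image inj_on_def card_Diff_subset distinct_card)

lemma permutation_next_prob:
  fixes X :: "'a set"
  assumes X: "finite X" and ys: "ys \<in> permutations_of_set X" and U: "U \<inter> set (take e ys) = {}"
  defines "M \<equiv> pmf_of_set (permutations_of_set X)"
  shows "measure_pmf.prob M {xs. take e xs = take e ys \<and> set (take (Suc e) xs) \<inter> U \<noteq> {}} =
    1 / real (card X - e) * real (card (U \<inter> X)) * measure_pmf.prob M {xs. take e xs = take e ys}"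
proof (cases "e < card X")
  \<comment> \<open>Here \<open>1 / real (card X - e)\<close> is \<open>1 / 0\<close>, hence 0. The
    left side is 0 too, since no entry is left to hit \<open>U\<close>.\<close>
  case False
  have "measure_pmf.prob M {xs. take e xs = take e ys \<and> set (take (Suc e) xs) \<inter> U \<noteq> {}} =
      measure_pmf.prob M {}"
    using X U False unfolding M_def
    by (intro prob_cong_support) (auto simp: length_finite_permutations_of_set)
  then show ?thesis using False by simp
next
  case True
  define v where "v = take e ys"
  have len: "length v = e"
    using True ys by (simp add: v_def length_finite_permutations_of_set)
  have v: "distinct v" "set v \<subseteq> X"
    using ys by (auto simp: v_def permutations_of_set_def dest: in_set_takeD)
  have prob: "measure_pmf.prob M S = real (card (permutations_of_set X \<inter> S)) / fact (card X)" for S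
    using X by (simp add: M_def measure_pmf_of_set)
  have take_Suc: "take (Suc e) xs = v @ [x] \<longleftrightarrow> take e xs = v \<and> xs ! e = x"
    if "xs \<in> permutations_of_set X" for xs x
    using that True len X by (auto simp: take_Suc_conv_app_nth length_finite_permutations_of_set)
  have "permutations_of_set X \<inter> {xs. take e xs = v \<and> set (take (Suc e) xs) \<inter> U \<noteq> {}} =
      (\<Union>x\<in>U \<inter> X. {xs \<in> permutations_of_set X. take (length (v @ [x])) xs = v @ [x]})"
  proof (intro equalityI subsetI)
    fix xs assume "xs \<in> permutations_of_set X \<inter> {xs. take e xs = v \<and> set (take (Suc e) xs) \<inter> U \<noteq> {}}"
    then have xs: "xs \<in> permutations_of_set X" "take e xs = v" "set (take (Suc e) xs) \<inter> U \<noteq> {}" by auto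
    then have ts: "take (Suc e) xs = v @ [xs ! e]" using take_Suc by blast
    then have "xs ! e \<in> U" using xs(3) U by (auto simp: v_def)
    moreover have "xs ! e \<in> X"
      using xs(1) True X by (metis length_finite_permutations_of_set nth_mem permutations_of_setD(1))
    ultimately show "xs \<in> (\<Union>x\<in>U \<inter> X. {xs \<in> permutations_of_set X. take (length (v @ [x])) xs = v @ [x]})"
      using xs(1) ts len by auto
  next
    fix xs assume "xs \<in> (\<Union>x\<in>U \<inter> X. {xs \<in> permutations_of_set X. take (length (v @ [x])) xs = v @ [x]})"
    then obtain x where "x \<in> U" "xs \<in> permutations_of_set X" "take (Suc e) xs = v @ [x]"
      using len by auto
    then show "xs \<in> permutations_of_set X \<inter> {xs. take e xs = v \<and> set (take (Suc e) xs) \<inter> U \<noteq> {}}"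
      using take_Suc[of xs x] by simp
  qed
  also have "card \<dots> = (\<Sum>x\<in>U \<inter> X. card {xs \<in> permutations_of_set X. take (length (v @ [x])) xs = v @ [x]})"
    using X by (intro card_UN_disjoint) auto
  also have "\<dots> = (\<Sum>x\<in>U \<inter> X. fact (card X - Suc e))"
  proof (rule sum.cong[OF refl])
    fix x assume "x \<in> U \<inter> X"
    then have "distinct (v @ [x])" "set (v @ [x]) \<subseteq> X" using v U by (auto simp: v_def)
    from card_permutations_with_prefix[OF X this]
    show "card {xs \<in> permutations_of_set X. take (length (v @ [x])) xs = v @ [x]} = fact (card X - Suc e)"
      using len by simp
  qed
  finally have num: "card (permutations_of_set X \<inter> {xs. take e xs = v \<and> set (take (Suc e) xs) \<inter> U \<noteq> {}}) =
      card (U \<inter> X) * fact (card X - Suc e)" by simp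
  have "permutations_of_set X \<inter> {xs. take e xs = v} = {xs \<in> permutations_of_set X. take (length v) xs = v}"
    using len by auto
  then have den: "card (permutations_of_set X \<inter> {xs. take e xs = v}) = fact (card X - e)"
    using card_permutations_with_prefix[OF X v] len by simp
  have "card X - e = Suc (card X - Suc e)" using True by simp
  then have "(fact (card X - e) :: real) = real (card X - e) * fact (card X - Suc e)"
    by (metis fact_Suc)
  then show ?thesis
    using True by (simp add: prob num den flip: v_def)
qed

lemma bins_adv_collision_prob:
  assumes k: "k \<in> {1..m}" and part: "bins_partition m k \<B>"
  shows "id_generator m (bins m \<B>)"
    and "adv_collision_prob (bins m \<B>) Z \<le>
      2 * measure_pmf.expectation (final_profile (bins m \<B>) Z) (collision_prob (bins m \<B>))"
proof -
  have disj: "disjoint \<B>" and sub: "\<Union>\<B> \<subseteq> {1..m}" and card: "card \<B> = m div k"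
    and size: "\<And>B. B \<in> \<B> \<Longrightarrow> card B = k"
    using part by (auto simp: bins_partition_def)
  have pos: "0 < m div k" using k by (simp add: div_greater_zero_iff)
  have fin: "finite \<B>" "\<B> \<noteq> {}" using card pos card.infinite by fastforce+
  define P where "P = pmf_of_set (permutations_of_set \<B>)"
  define T where "T = sorted_list_of_set ({1..m} - \<Union>\<B>)"
  have supp: "set_pmf P = permutations_of_set \<B>" using fin by (simp add: P_def)
  interpret bin_layout P "m div k" "\<lambda>_. k" T
  proof
    fix Bs assume Bs: "Bs \<in> set_pmf P"
    show "length Bs = m div k"
      using Bs fin card by (simp add: supp length_finite_permutations_of_set)
    then show "card (Bs ! t) = k" if "t < m div k" for t
      using Bs that size by (auto simp: supp permutations_of_set_def)
    show "B \<inter> set T = {}" if "B \<in> set Bs" for B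
      using that Bs by (auto simp: T_def supp permutations_of_set_def)
    fix Bs' assume Bs': "Bs' \<in> set_pmf P"
    show "B \<inter> B' = {}" if "B \<in> set Bs" "B' \<in> set Bs'" "B \<noteq> B'" for B B'
      using that Bs Bs' disj by (auto simp: supp permutations_of_set_def disjoint_def)
    \<comment> \<open>Every permutation contains all bins, and \<open>\<B>\<close> is nonempty
      because \<open>k \<le> m\<close>.\<close>
    show "set Bs \<inter> set Bs' \<noteq> {}"
      using Bs Bs' fin by (auto simp: supp permutations_of_set_def)
  next
    show "0 < k" using k by simp
  qed
  have bins_eq: "bins m \<B> = map_pmf ids P"
  proof -
    have "ids = (\<lambda>Bs. concat (map sorted_list_of_set Bs) @ sorted_list_of_set ({1..m} - \<Union>\<B>))"
      by (rule ext, unfold ids_def, simp only: T_def)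
    then show ?thesis by (simp only: bins_def P_def)
  qed
  show "id_generator m (bins m \<B>)"
    unfolding id_generator_def bins_eq
  proof
    fix xs assume "xs \<in> set_pmf (map_pmf ids P)"
    then obtain Bs where Bs: "Bs \<in> set_pmf P" "xs = ids Bs" by auto
    have "set Bs = \<B>" "distinct Bs" using Bs(1) by (auto simp: supp permutations_of_set_def)
    moreover have "set T = {1..m} - \<Union>\<B>" "distinct T" by (simp_all add: T_def)
    ultimately show "distinct xs \<and> set xs \<subseteq> {1..m}"
      using Bs(2) sub distinct_ids[OF Bs(1)] set_ids[OF Bs(1)] by auto
  qed
  interpret bin_scheme P ids num_opened "\<lambda>_. \<B>" "\<lambda>l _. min l (m div k)" "\<lambda>e. 1 / real (m div k - e)"
  proof
    show "finite (set_pmf P)" by (simp add: supp fin)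
    fix Bs assume Bs: "Bs \<in> set_pmf P"
    show "card (set (take l Bs) \<inter> \<B>) = min l (m div k)" for l e
    proof -
      have "set (take l Bs) \<inter> \<B> = set (take l Bs)"
        using Bs by (auto simp: supp permutations_of_set_def dest: in_set_takeD)
      moreover have "distinct (take l Bs)" using Bs by (simp add: supp permutations_of_set_def)
      ultimately show ?thesis using length_bins[OF Bs] by (simp add: distinct_card min.commute)
    qed
    show "measure_pmf.prob P {Bs'. take e Bs' = take e Bs \<and> set (take (Suc e) Bs') \<inter> U \<noteq> {}} =
        1 / real (m div k - e) * real (card (U \<inter> \<B>)) * measure_pmf.prob P {Bs'. take e Bs' = take e Bs}"
      if "U \<inter> set (take e Bs) = {}" for U e
      using permutation_next_prob[OF fin(1) Bs[unfolded supp] that] by (simp add: P_def card)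
  qed ((rule num_opened_0 num_opened_Suc answer_cong output_ids_disjoint_iff; assumption) | simp)+
  show "adv_collision_prob (bins m \<B>) Z \<le>
      2 * measure_pmf.expectation (final_profile (bins m \<B>) Z) (collision_prob (bins m \<B>))"
    unfolding bins_eq by (rule adv_collision_prob_le)
qed

subsection \<open>The algorithm \<open>Bins\<^sup>*\<close>\<close>

text \<open>The bins of different chunks are drawn independently, so the prefix has no influence on
  the next bin. Positions count from 0 and chunks from 1, hence \<open>p (Suc e)\<close>.\<close>

lemma Pi_pmf_next_prob:
  fixes p :: "nat \<Rightarrow> 'a pmf" and dflt :: 'a
  assumes e: "e < C" and U: "U \<inter> set (take e ys) = {}" and len: "length ys = C"
  defines "M \<equiv> map_pmf (\<lambda>b. map b [1..<Suc C]) (Pi_pmf {1..C} dflt p)"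
  shows "measure_pmf.prob M {xs. take e xs = take e ys \<and> set (take (Suc e) xs) \<inter> U \<noteq> {}} =
    measure_pmf.prob (p (Suc e)) U * measure_pmf.prob M {xs. take e xs = take e ys}"
proof -
  \<comment> \<open>A product set: coordinates up to \<open>e\<close> are fixed by
    \<open>ys\<close>, coordinate \<open>Suc e\<close> lies in \<open>V\<close>, the others are
    free. \<open>V = U\<close> and \<open>V = UNIV\<close> give the two events of the claim.\<close>
  define F where "F = (\<lambda>V i. if i \<le> e then {ys ! (i - 1)} else if i = Suc e then V else UNIV)"
  have take_eq: "take e (map b [1..<Suc C]) = take e ys \<longleftrightarrow> (\<forall>i\<in>{1..e}. b i = ys ! (i - 1))"
    for b :: "nat \<Rightarrow> 'a"
  proof -
    have "take e (map b [1..<Suc C]) = take e ys \<longleftrightarrow> (\<forall>t<e. b (Suc t) = ys ! t)"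
      using e len by (auto simp: list_eq_iff_nth_eq simp del: upt_Suc)
    also have "\<dots> \<longleftrightarrow> (\<forall>i\<in>{1..e}. b i = ys ! (i - 1))"
    proof (intro iffI ballI allI impI)
      fix i assume "\<forall>t<e. b (Suc t) = ys ! t" "i \<in> {1..e}"
      then show "b i = ys ! (i - 1)" by (cases i) auto
    next
      fix t assume "\<forall>i\<in>{1..e}. b i = ys ! (i - 1)" "t < e"
      then show "b (Suc t) = ys ! t" using bspec[of "{1..e}" _ "Suc t"] by fastforce
    qed
    finally show ?thesis .
  qed
  have take_Suc: "take (Suc e) (map b [1..<Suc C]) = take e (map b [1..<Suc C]) @ [b (Suc e)]"
    for b :: "nat \<Rightarrow> 'a"
    using e by (subst take_Suc_conv_app_nth) (auto simp del: upt_Suc)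
  have Pi_F: "b \<in> Pi {1..C} (F V) \<longleftrightarrow> take e (map b [1..<Suc C]) = take e ys \<and> b (Suc e) \<in> V"
    for b V
    using e unfolding take_eq by (auto simp: F_def Pi_iff)
  have cyl: "measure_pmf.prob (Pi_pmf {1..C} dflt p) (Pi {1..C} (F V)) =
      measure_pmf.prob (p (Suc e)) V * (\<Prod>i\<in>{1..C} - {Suc e}. measure_pmf.prob (p i) (F UNIV i))" for V
  proof -
    have "measure_pmf.prob (Pi_pmf {1..C} dflt p) (Pi {1..C} (F V)) =
        (\<Prod>i\<in>{1..C}. measure_pmf.prob (p i) (F V i))"
      by (rule measure_Pi_pmf_Pi) simp
    also have "\<dots> = measure_pmf.prob (p (Suc e)) V * (\<Prod>i\<in>{1..C} - {Suc e}. measure_pmf.prob (p i) (F V i))"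
      using e by (subst prod.remove[of _ "Suc e"]) (auto simp: F_def)
    also have "(\<Prod>i\<in>{1..C} - {Suc e}. measure_pmf.prob (p i) (F V i)) =
        (\<Prod>i\<in>{1..C} - {Suc e}. measure_pmf.prob (p i) (F UNIV i))"
      by (intro prod.cong) (auto simp: F_def)
    finally show ?thesis .
  qed
  have "measure_pmf.prob M {xs. take e xs = take e ys \<and> set (take (Suc e) xs) \<inter> U \<noteq> {}} =
      measure_pmf.prob (Pi_pmf {1..C} dflt p) (Pi {1..C} (F U))"
    unfolding M_def measure_map_pmf
    by (rule prob_cong_support, unfold mem_Collect_eq vimage_def Pi_F take_Suc)
      (use U in \<open>auto simp del: upt_Suc\<close>)
  moreover have "measure_pmf.prob M {xs. take e xs = take e ys} =
      measure_pmf.prob (Pi_pmf {1..C} dflt p) (Pi {1..C} (F UNIV))"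
    unfolding M_def measure_map_pmf
    by (rule prob_cong_support, unfold mem_Collect_eq vimage_def Pi_F) simp
  moreover have "measure_pmf.prob (p (Suc e)) UNIV = 1" by simp
  ultimately show ?thesis by (simp only: cyl mult_1_left)
qed

lemma bins_star_adv_collision_prob:
  assumes part: "bins_star_partition m \<C>"
  shows "id_generator m (bins_star m \<C>)"
    and "adv_collision_prob (bins_star m \<C>) Z \<le>
      2 * measure_pmf.expectation (final_profile (bins_star m \<C>) Z) (collision_prob (bins_star m \<C>))"
proof -
  define C where "C = num_chunks m"
  have chunks_disj: "disjoint_family_on (\<lambda>i. \<Union>(\<C> i)) {1..C}"
    and sub: "\<And>i. i \<in> {1..C} \<Longrightarrow> \<Union>(\<C> i) \<subseteq> {1..m}"
    and disj: "\<And>i. i \<in> {1..C} \<Longrightarrow> disjoint (\<C> i)"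
    and card: "\<And>i. i \<in> {1..C} \<Longrightarrow> card (\<C> i) = 2 ^ (C - i)"
    and size: "\<And>i B. i \<in> {1..C} \<Longrightarrow> B \<in> \<C> i \<Longrightarrow> card B = 2 ^ (i - 1)"
    using part unfolding bins_star_partition_def Let_def C_def by blast+
  have fin: "finite (\<C> i)" "\<C> i \<noteq> {}" if "i \<in> {1..C}" for i
    using card[OF that] card.infinite by fastforce+
  have nonempty: "B \<noteq> {}" "finite B" if "i \<in> {1..C}" "B \<in> \<C> i" for i B
    using size[OF that] card.infinite by fastforce+
  have across: "B \<inter> B' = {}" if "i \<in> {1..C}" "j \<in> {1..C}" "i \<noteq> j" "B \<in> \<C> i" "B' \<in> \<C> j" for i j B B'
    using disjoint_family_onD[OF chunks_disj that(1,2,3)] that(4,5) by blast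
  define P where "P = map_pmf (\<lambda>b. map b [1..<Suc C]) (Pi_pmf {1..C} {} (\<lambda>i. pmf_of_set (\<C> i)))"
  have len: "length Bs = C" if "Bs \<in> set_pmf P" for Bs
    using that by (auto simp: P_def simp del: upt_Suc)
  have nth: "Bs ! t \<in> \<C> (Suc t)" if Bs: "Bs \<in> set_pmf P" and t: "t < C" for Bs t
  proof -
    obtain b where b: "b \<in> set_pmf (Pi_pmf {1..C} {} (\<lambda>i. pmf_of_set (\<C> i)))" "Bs = map b [1..<Suc C]"
      using Bs unfolding P_def set_map_pmf by blast
    have i: "Suc t \<in> {1..C}" using t by simp
    then have "b (Suc t) \<in> set_pmf (pmf_of_set (\<C> (Suc t)))"
      using b(1) by (simp add: set_Pi_pmf PiE_dflt_def)
    then have "b (Suc t) \<in> \<C> (Suc t)" using fin[OF i] by simp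
    then show ?thesis using b(2) t by (simp del: upt_Suc)
  qed
  have mem: "\<exists>t<C. B \<in> \<C> (Suc t)" if "Bs \<in> set_pmf P" "B \<in> set Bs" for Bs B
    using that nth len by (metis in_set_conv_nth)
  have mem_disj: "B \<inter> B' = {}" if "t < C" "t' < C" "B \<in> \<C> (Suc t)" "B' \<in> \<C> (Suc t')" "B \<noteq> B'" for B B' t t'
  proof (cases "t = t'")
    case True
    then show ?thesis using disj[of "Suc t"] that by (auto simp: disjoint_def)
  next
    case False
    then show ?thesis using that across[of "Suc t" "Suc t'" B B'] by simp
  qed
  interpret bin_layout P C "\<lambda>t. 2 ^ t" "[]"
  proof
    fix Bs assume Bs: "Bs \<in> set_pmf P"
    show "length Bs = C" by (rule len[OF Bs])
    show "card (Bs ! t) = 2 ^ t" if "t < C" for t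
      using size[OF _ nth[OF Bs that]] that by simp
    fix Bs' assume Bs': "Bs' \<in> set_pmf P"
    show "B \<inter> B' = {}" if "B \<in> set Bs" "B' \<in> set Bs'" "B \<noteq> B'" for B B'
      using mem[OF Bs that(1)] mem[OF Bs' that(2)] mem_disj that(3) by blast
  qed auto
  have star_eq: "bins_star m \<C> = map_pmf ids P"
    by (simp only: bins_star_def P_def C_def ids_def pmf.map_comp o_def map_map append_Nil2)
  \<comment> \<open>A bin lying in two chunks would be disjoint from itself; nonemptiness rules this
    out.\<close>
  have other_chunk: "Bs ! t \<notin> \<C> (Suc e)" if "Bs \<in> set_pmf P" "t < C" "e < C" "t \<noteq> e" for Bs t e
    using nth[OF that(1,2)] nonempty(1)[of "Suc t"] across[of "Suc t" "Suc e" "Bs ! t" "Bs ! t"] that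
    by auto
  show "id_generator m (bins_star m \<C>)"
    unfolding id_generator_def star_eq
  proof
    fix xs assume "xs \<in> set_pmf (map_pmf ids P)"
    then obtain Bs where Bs: "Bs \<in> set_pmf P" "xs = ids Bs" by auto
    have "distinct Bs"
      unfolding distinct_conv_nth
    proof (intro allI impI)
      fix i j assume "i < length Bs" "j < length Bs" "i \<noteq> j"
      then show "Bs ! i \<noteq> Bs ! j"
        using other_chunk[OF Bs(1), of i j] nth[OF Bs(1), of j] len[OF Bs(1)] by auto
    qed
    moreover have "B \<subseteq> {1..m}" if B: "B \<in> set Bs" for B
    proof -
      obtain t where t: "t < C" "B \<in> \<C> (Suc t)" using mem[OF Bs(1) B] by blast
      then have "Suc t \<in> {1..C}" by simp
      then show ?thesis using sub t(2) by blast
    qed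
    ultimately show "distinct xs \<and> set xs \<subseteq> {1..m}"
      using Bs(2) distinct_ids[OF Bs(1)] set_ids[OF Bs(1)] by auto
  qed
  \<comment> \<open>Class \<open>K e\<close> is chunk \<open>e + 1\<close>: every sequence takes
    exactly one bin from it, namely its entry at position \<open>e\<close>, uniform among
    \<open>2 ^ (C - Suc e)\<close> bins. Beyond the last chunk the class is empty.\<close>
  interpret bin_scheme P ids num_opened "\<lambda>e. if e < C then \<C> (Suc e) else {}"
    "\<lambda>l e. if e < l \<and> e < C then 1 else 0" "\<lambda>e. 1 / 2 ^ (C - Suc e)"
  proof
    have "finite (PiE_dflt {1..C} {} (set_pmf \<circ> (\<lambda>i. pmf_of_set (\<C> i))))"
      using fin by (intro finite_PiE_dflt) auto
    then show "finite (set_pmf P)"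
      unfolding P_def set_map_pmf set_Pi_pmf[OF finite_atLeastAtMost] by (rule finite_imageI)
    fix Bs assume Bs: "Bs \<in> set_pmf P"
    show "card (set (take l Bs) \<inter> (if e < C then \<C> (Suc e) else {})) = (if e < l \<and> e < C then 1 else 0)" for l e
    proof (cases "e < C")
      case True
      have "set (take l Bs) \<inter> \<C> (Suc e) = (if e < l then {Bs ! e} else {})"
      proof (intro set_eqI iffI)
        fix B assume "B \<in> set (take l Bs) \<inter> \<C> (Suc e)"
        then obtain t where t: "t < l" "t < C" "B = Bs ! t" "Bs ! t \<in> \<C> (Suc e)"
          using len[OF Bs] by (auto simp: in_set_conv_nth)
        then have "t = e" using other_chunk[OF Bs _ True, of t] by blast
        then show "B \<in> (if e < l then {Bs ! e} else {})" using t by simp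
      next
        fix B assume "B \<in> (if e < l then {Bs ! e} else {})"
        then have "e < l" "B = Bs ! e" by (auto split: if_splits)
        moreover have "take l Bs ! e \<in> set (take l Bs)"
          using \<open>e < l\<close> True len[OF Bs] by (intro nth_mem) simp
        ultimately show "B \<in> set (take l Bs) \<inter> \<C> (Suc e)"
          using nth[OF Bs True] by simp
      qed
      then show ?thesis using True by simp
    qed simp
    show "measure_pmf.prob P {Bs'. take e Bs' = take e Bs \<and> set (take (Suc e) Bs') \<inter> U \<noteq> {}} =
        1 / 2 ^ (C - Suc e) * real (card (U \<inter> (if e < C then \<C> (Suc e) else {}))) *
        measure_pmf.prob P {Bs'. take e Bs' = take e Bs}"
      if U: "U \<inter> set (take e Bs) = {}" for U e
    proof (cases "e < C")
      case True
      then have "measure_pmf.prob (pmf_of_set (\<C> (Suc e))) U = card (U \<inter> \<C> (Suc e)) / 2 ^ (C - Suc e)"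
        using fin[of "Suc e"] card[of "Suc e"] by (simp add: measure_pmf_of_set Int_commute)
      moreover note Pi_pmf_next_prob[OF True U len[OF Bs], of "{}" "\<lambda>i. pmf_of_set (\<C> i)", folded P_def]
      ultimately show ?thesis using True by (simp only: if_True) simp
    next
      case False
      have "measure_pmf.prob P {Bs'. take e Bs' = take e Bs \<and> set (take (Suc e) Bs') \<inter> U \<noteq> {}} =
          measure_pmf.prob P {}"
        using U False by (intro prob_cong_support) (auto simp: len)
      then show ?thesis using False by simp
    qed
  qed ((rule num_opened_0 num_opened_Suc answer_cong output_ids_disjoint_iff; assumption) | simp)+
  show "adv_collision_prob (bins_star m \<C>) Z \<le>
      2 * measure_pmf.expectation (final_profile (bins_star m \<C>) Z) (collision_prob (bins_star m \<C>))"
    unfolding star_eq by (rule adv_collision_prob_le)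
qed

subsection \<open>The optimal collision probability\<close>

text \<open>Some ID is the first ID of an instance with probability at least \<open>1 / m\<close>.\<close>

lemma id_algorithm_collision_prob:
  assumes A: "id_algorithm m A" and m: "0 < m" and D: "demand_profile D" "2 \<le> length D"
  shows "(1 / real m)\<^sup>2 \<le> collision_prob A D"
proof -
  have A_supp: "xs \<noteq> []" "set xs = {1..m}" if "xs \<in> set_pmf A" for xs
    using that A m by (fastforce simp: id_algorithm_def permutations_of_set_def)+
  have sum1: "(\<Sum>x\<in>{1..m}. pmf (map_pmf hd A) x) = 1"
    using A_supp by (intro sum_pmf_eq_1) (auto simp del: atLeastAtMost_iff dest: hd_in_set)
  obtain x where x: "1 / real m \<le> pmf (map_pmf hd A) x"
  proof (rule ccontr)
    assume "\<not> thesis"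
    then have "pmf (map_pmf hd A) x < 1 / real m" for x
      using that by (meson not_le)
    then have "(\<Sum>x\<in>{1..m}. pmf (map_pmf hd A) x) < (\<Sum>x\<in>{1..m}. 1 / real m)"
      using m by (intro sum_strict_mono) auto
    then show False using sum1 m by simp
  qed
  let ?S = "{xs. hd xs = x}"
  \<comment> \<open>The first two instances both begin with \<open>x\<close>; the others are
    unconstrained and contribute factors 1.\<close>
  define S where "S = (\<lambda>j::nat. if j < 2 then ?S else UNIV)"
  have p: "measure_pmf.prob A ?S = pmf (map_pmf hd A) x"
    by (simp add: pmf_map vimage_def)
  have "(\<Prod>j<length D. measure_pmf.prob A (S j)) = (\<Prod>j<2. measure_pmf.prob A (S j))"
    using D(2) by (intro prod.mono_neutral_right) (auto simp: S_def)
  also have "\<dots> = (pmf (map_pmf hd A) x)\<^sup>2" by (simp add: S_def p)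
  finally have "(1 / real m)\<^sup>2 \<le> (\<Prod>j<length D. measure_pmf.prob A (S j))"
    using x by (simp add: power_mono)
  also have "\<dots> = measure_pmf.prob (replicate_pmf (length D) A) {xss. \<forall>j<length D. xss ! j \<in> S j}"
    by (rule prob_replicate_pmf_cylinder[symmetric])
  also have "\<dots> \<le> collision_prob A D"
    unfolding collision_prob_def
  proof (rule prob_mono_support)
    fix xss assume xss: "xss \<in> set_pmf (replicate_pmf (length D) A)"
      "xss \<in> {xss. \<forall>j<length D. xss ! j \<in> S j}"
    have "x \<in> output_ids (zip xss D ! j)" if "j < 2" for j
    proof -
      have j: "j < length D" using that D(2) by simp
      have "D ! j \<ge> 1" using D(1) j by (simp add: demand_profile_def)
      moreover have "hd (xss ! j) = x" using xss(2) j that by (auto simp: S_def)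
      moreover have "xss ! j \<noteq> []" using A_supp(1) nth_replicate_pmf[OF xss(1) j] by blast
      ultimately show ?thesis
        using j length_replicate_pmf[OF xss(1)] by (cases "xss ! j"; cases "D ! j") (auto simp: output_ids_def)
    qed
    from this[of 0] this[of 1]
    have "output_ids (zip xss D ! 0) \<inter> output_ids (zip xss D ! 1) \<noteq> {}" by force
    moreover have "1 < length (zip xss D)" using D(2) length_replicate_pmf[OF xss(1)] by simp
    ultimately show "xss \<in> {xss. collision (zip xss D)}"
      unfolding collision_def mem_Collect_eq by (metis zero_less_one)
  qed
  finally show ?thesis .
qed

text \<open>For \<open>m > 0\<close> the lower bound \<open>(1 / real m)\<^sup>2\<close> holds for
  all algorithms at once, so the infimum stays positive and the competitive ratio divides by a
  positive number.\<close>

lemma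
  shows opt_prob_nonneg: "0 \<le> opt_prob m D" and opt_prob_le_1: "opt_prob m D \<le> 1"
    and opt_prob_pos: "0 < m \<Longrightarrow> demand_profile D \<Longrightarrow> 2 \<le> length D \<Longrightarrow> 0 < opt_prob m D"
proof -
  have "permutations_of_set {1..m} \<noteq> {}" by simp
  then obtain xs where "xs \<in> permutations_of_set {1..m}" by blast
  then have ex: "return_pmf xs \<in> {A. id_algorithm m A}" by (simp add: id_algorithm_def)
  have bdd: "bdd_below ((\<lambda>A. collision_prob A D) ` {A. id_algorithm m A})"
    by (rule bdd_belowI[of _ 0]) (auto simp: collision_prob_def)
  show "0 \<le> opt_prob m D"
    unfolding opt_prob_def using ex by (intro cINF_greatest) (auto simp: collision_prob_def)
  have "opt_prob m D \<le> collision_prob (return_pmf xs) D"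
    unfolding opt_prob_def by (rule cINF_lower[OF bdd ex])
  also have "\<dots> \<le> 1" by (simp add: collision_prob_def)
  finally show "opt_prob m D \<le> 1" .
  assume *: "0 < m" "demand_profile D" "2 \<le> length D"
  have "(1 / real m)\<^sup>2 \<le> opt_prob m D"
    unfolding opt_prob_def using ex * by (intro cINF_greatest) (auto intro: id_algorithm_collision_prob)
  moreover have "0 < (1 / real m)\<^sup>2" using *(1) by simp
  ultimately show "0 < opt_prob m D" by linarith
qed

text \<open>Handles \<open>m = 0\<close>, where the optimal probability vanishes too and the ratio,
  a division by 0, carries no information.\<close>

lemma collision_prob_empty_universe:
  assumes "id_generator 0 A"
  shows "collision_prob A D = 0"
proof -
  have "collision_prob A D = measure_pmf.prob (replicate_pmf (length D) A) {}"
    unfolding collision_prob_def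
  proof (rule prob_cong_support)
    fix xss assume xss: "xss \<in> set_pmf (replicate_pmf (length D) A)"
    have "xss ! j = []" if "j < length D" for j
      using assms nth_replicate_pmf[OF xss that] by (auto simp: id_generator_def)
    then show "xss \<in> {xss. collision (zip xss D)} \<longleftrightarrow> xss \<in> {}"
      using length_replicate_pmf[OF xss] by (auto simp: collision_def output_ids_def)
  qed
  then show ?thesis by simp
qed

section \<open>From the factor two to the competitive ratios\<close>

theorem theorem3p11:
  fixes m :: nat and A :: "nat list pmf" and \<D> :: "nat list set" and c :: real
  assumes "(\<exists>\<C>. bins_star_partition m \<C> \<and> A = bins_star m \<C>) \<or>
           (\<exists>k\<in>{1..m}. \<exists>\<B>. bins_partition m k \<B> \<and> A = bins m \<B>)"
    and "\<And>D. D \<in> \<D> \<Longrightarrow> demand_profile D \<and> length D \<ge> 2"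
    and "competitive_ratio m A \<D> = ereal c"
  shows "adv_competitive_ratio m A (Adv m \<D>) \<le> ereal (4 * c)"
proof -
  have "id_generator m A \<and> (\<forall>Z. adv_collision_prob A Z \<le>
      2 * measure_pmf.expectation (final_profile A Z) (collision_prob A))"
    using assms(1)
  proof (elim disjE exE bexE conjE)
    fix \<C> assume "bins_star_partition m \<C>" "A = bins_star m \<C>"
    then show ?thesis using bins_star_adv_collision_prob[of m \<C>] by simp
  next
    fix k \<B> assume "k \<in> {1..m}" "bins_partition m k \<B>" "A = bins m \<B>"
    then show ?thesis using bins_adv_collision_prob[of k m \<B>] by simp
  qed
  then have gen: "id_generator m A"
    and adv: "\<And>Z. adv_collision_prob A Z \<le>
      2 * measure_pmf.expectation (final_profile A Z) (collision_prob A)" by simp_all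
  have ratio: "collision_prob A D / opt_prob m D \<le> c" if "D \<in> \<D>" for D
  proof -
    have "ereal (collision_prob A D / opt_prob m D) \<le> ereal c"
      unfolding assms(3)[symmetric] competitive_ratio_def by (rule SUP_upper[OF that])
    then show ?thesis by simp
  qed
  have c_nonneg: "0 \<le> c" if "D \<in> \<D>" for D
  proof -
    have "0 \<le> collision_prob A D / opt_prob m D"
      by (intro divide_nonneg_nonneg opt_prob_nonneg) (simp add: collision_prob_def)
    then show ?thesis using ratio[OF that] by simp
  qed
  have bound: "collision_prob A D \<le> c * opt_prob m D" if "D \<in> \<D>" for D
  proof (cases "m = 0")
    case True
    then show ?thesis
      using gen c_nonneg[OF that] opt_prob_nonneg[of m D] by (simp add: collision_prob_empty_universe)
  next
    case False
    then have "0 < opt_prob m D" using assms(2)[OF that] by (intro opt_prob_pos) auto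
    then show ?thesis using ratio[OF that] by (simp add: pos_divide_le_eq)
  qed
  show ?thesis
    unfolding adv_competitive_ratio_def
  proof (rule SUP_least)
    fix Z assume "Z \<in> Adv m \<D>"
    \<comment> \<open>\<open>Adv\<close> controls the final profiles of plays against generators,
      and \<open>A\<close> is one.\<close>
    then have supp: "set_pmf (final_profile A Z) \<subseteq> \<D>" using gen by (auto simp: Adv_def)
    let ?opt = "measure_pmf.expectation (final_profile A Z) (opt_prob m)"
    \<comment> \<open>Some final profile occurs, so \<open>\<D>\<close> has a member, and its ratio
      is nonnegative.\<close>
    have "0 \<le> c" using supp set_pmf_not_empty[of "final_profile A Z"] c_nonneg by blast
    have "measure_pmf.expectation (final_profile A Z) (collision_prob A) \<le>
        measure_pmf.expectation (final_profile A Z) (\<lambda>D. c * opt_prob m D)"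
      using supp bound
      by (intro integral_mono_AE integrable_mult_right integrable_pmf_bounded[where B = 1])
        (auto simp: AE_measure_pmf_iff collision_prob_def opt_prob_nonneg opt_prob_le_1)
    then have "adv_collision_prob A Z \<le> 2 * c * ?opt" using adv[of Z] by simp
    \<comment> \<open>The argument yields the factor 2; the factor 4 follows as \<open>c\<close> and
      the expectation are nonnegative.\<close>
    also have "\<dots> \<le> 4 * c * ?opt"
      using \<open>0 \<le> c\<close> by (intro mult_right_mono Bochner_Integration.integral_nonneg opt_prob_nonneg) auto
    finally have le: "adv_collision_prob A Z \<le> 4 * c * ?opt" .
    have "0 \<le> ?opt" by (intro Bochner_Integration.integral_nonneg opt_prob_nonneg)
    \<comment> \<open>If the expected optimum is 0, the quotient is 0 by convention and
      \<open>0 \<le> c\<close> suffices.\<close>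
    then have "adv_collision_prob A Z / ?opt \<le> 4 * c"
      using le \<open>0 \<le> c\<close> by (cases "?opt = 0") (auto simp: pos_divide_le_eq)
    then show "ereal (adv_collision_prob A Z / ?opt) \<le> ereal (4 * c)" by simp
  qed
qed

end
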